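(* Let $\rho\in\mathbb C$ with $\operatorname{Re}\rho>0$, $m\in\mathbb N$ and $n\in\mathbb N$. Let the $n$-th derivative $f^{(n)}$ of a function $f(x)$ be continuous (or piecewise continuous) in $(0,\infty)$ and satisfy $|f^{(n)}(x)|\leq Kx^{m\operatorname{Re}\rho}e^{x/\beta}$ for all $x>T$, where $K,T,\beta$ are positive constants; let $u,v,\omega$ be such that $\omega\in(0,\mu)$ and $\operatorname{Re}u>\mu/\beta$ for some positive constant $\mu$. Then $$\begin{aligned}\mathcal M_{\rho,m}[f^{(n)}(x)](u,v,\omega)=&\ \frac{u^n}{\omega^n}\mathcal M_{\rho,m}[f(x)](u,v,\omega)-\delta_{v,0}\sum_{k=0}^{n-1}\frac{u^k}{\omega^{m\rho+k+1}}f^{(n-k-1)}(0)\\&-v\omega\sum_{k=0}^{n-1}\frac{u^k}{\omega^k}\mathcal M_{\rho,m}[x^{-2}f^{(n-k-1)}(x)](u,v,\omega)\\&+\frac{m\rho}{\omega^m}\sum_{k=0}^{n-1}\frac{u^k}{\omega^k}\mathcal M_{\rho+1,m}[x^{m-1}f^{(n-k-1)}(x)](u,v,\omega),\end{aligned}$$ where $\delta_{v,0}=1$ if $v=0$ and $\delta_{v,0}=0$ if $v\neq0$.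
   Context: $\mathbb N=\{1,2,\dots\}$. For $u,v\in\mathbb C$, $\omega\in\mathbb R^+$ (positive reals) and a function $f$ on $(0,\infty)$, $$\mathcal M_{\rho,m}[f(x)](u,v,\omega)=\int_0^\infty \frac{e^{-ux-v/x}}{(x^m+\omega^m)^\rho}f(\omega x)\,dx.$$
   Formalization: Added condition at 0: if v=0 or Re v>0, the right limits f^(j)(0), j<n, exist; or else v≠0 and all transforms in the formula converge at 0. Without it terms may be undefined, e.g. f=exp(1/x²), v=1. *)

theory Defs
  imports "HOL-Analysis.Analysis"
begin

definition M_integrand ::
  "complex \<Rightarrow> nat \<Rightarrow> (real \<Rightarrow> complex) \<Rightarrow> complex \<Rightarrow> complex \<Rightarrow> real \<Rightarrow> real \<Rightarrow> complex" where
  "M_integrand \<rho> m f u v \<omega> x =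
     exp (- u * of_real x - v / of_real x) / (of_real (x ^ m + \<omega> ^ m) powr \<rho>) * f (\<omega> * x)"

text \<open>The improper integral over the half-line is taken as a Henstock--Kurzweil integral. For
  integrands that are Riemann integrable on compact subintervals of the open half-line it exists
  exactly when the improper Riemann integral converges, possibly only conditionally, and has the
  same value. Its value is 0 if the integral does not converge.\<close>

definition M_transform ::
  "complex \<Rightarrow> nat \<Rightarrow> (real \<Rightarrow> complex) \<Rightarrow> complex \<Rightarrow> complex \<Rightarrow> real \<Rightarrow> complex" where
  "M_transform \<rho> m f u v \<omega> = integral {0<..} (M_integrand \<rho> m f u v \<omega>)"

definition M_converges ::
  "complex \<Rightarrow> nat \<Rightarrow> (real \<Rightarrow> complex) \<Rightarrow> complex \<Rightarrow> complex \<Rightarrow> real \<Rightarrow> bool" where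
  "M_converges \<rho> m f u v \<omega> \<longleftrightarrow> M_integrand \<rho> m f u v \<omega> integrable_on {0<..}"

text \<open>Convergence at the lower limit only; nothing is said about infinity.\<close>

definition M_converges_at_0 ::
  "complex \<Rightarrow> nat \<Rightarrow> (real \<Rightarrow> complex) \<Rightarrow> complex \<Rightarrow> complex \<Rightarrow> real \<Rightarrow> bool" where
  "M_converges_at_0 \<rho> m f u v \<omega> \<longleftrightarrow> (\<exists>c>0. M_integrand \<rho> m f u v \<omega> integrable_on {0<..c})"

definition nth_deriv :: "nat \<Rightarrow> (real \<Rightarrow> complex) \<Rightarrow> real \<Rightarrow> complex" where
  "nth_deriv n f = ((\<lambda>g x. vector_derivative g (at x)) ^^ n) f"

text \<open>A function on the open half-line need not be defined at 0, so its value there is the limit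
  from the right.\<close>

definition value_at_0 :: "(real \<Rightarrow> complex) \<Rightarrow> complex" where
  "value_at_0 g = Lim (at_right 0) g"

text \<open>Piecewise continuity on the open half-line, with exceptional points \<open>P\<close>: finitely
  many in each compact subinterval, and finite one-sided limits at each of them. The value at a
  point of \<open>P\<close> is irrelevant. Continuity is the case \<open>P = {}\<close>.\<close>

definition piecewise_continuous_pos :: "real set \<Rightarrow> (real \<Rightarrow> complex) \<Rightarrow> bool" where
  "piecewise_continuous_pos P g \<longleftrightarrow>
     P \<subseteq> {0<..} \<and>
     (\<forall>a b. 0 < a \<longrightarrow> finite (P \<inter> {a..b})) \<and>
     continuous_on ({0<..} - P) g \<and>
     (\<forall>p\<in>P. (\<exists>l. (g \<longlongrightarrow> l) (at_left p)) \<and> (\<exists>l. (g \<longlongrightarrow> l) (at_right p)))"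

text \<open>The \<open>n\<close>-th derivative (\<open>n \<ge> 1\<close>) is piecewise continuous. By Darboux's theorem a
  derivative has no jumps, so at the points of \<open>P\<close> the \<open>n\<close>-th derivative may fail
  to exist; the derivative of order \<open>n - 1\<close> is still continuous there.\<close>

definition has_piecewise_continuous_nth_deriv :: "nat \<Rightarrow> real set \<Rightarrow> (real \<Rightarrow> complex) \<Rightarrow> bool" where
  "has_piecewise_continuous_nth_deriv n P f \<longleftrightarrow>
     (\<forall>j. Suc j < n \<longrightarrow> (\<forall>x>0. nth_deriv j f differentiable (at x))) \<and>
     continuous_on {0<..} (nth_deriv (n - 1) f) \<and>
     (\<forall>x\<in>{0<..} - P. nth_deriv (n - 1) f differentiable (at x)) \<and>
     piecewise_continuous_pos P (nth_deriv n f)"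

end

theory Submission
  imports Defs
begin

text \<open>
  With \<open>E\<close> the kernel \<open>exp (- u x - v / x) / (x\<^sup>m + \<omega>\<^sup>m)\<^sup>\<rho>\<close>, the product rule for
  \<open>E(x) f\<^sup>(\<^sup>j\<^sup>)(\<omega> x)\<close> expresses the integrand of the transform of \<open>f\<^sup>(\<^sup>j\<^sup>+\<^sup>1\<^sup>)\<close> by that of
  \<open>f\<^sup>(\<^sup>j\<^sup>)\<close>, the two correction terms and a total derivative; integrating and iterating over \<open>j\<close>
  gives the formula. The boundary term at infinity vanishes because integrating the bound on the
  highest derivative bounds the lower ones in the same way. At 0, if \<open>v = 0\<close> or \<open>Re v > 0\<close>, the limit is
  read off the kernel. Otherwise the convergence of all other integrals yields that of the total
  derivative, so a limit exists; it is 0, because its quotient by \<open>x\<^sup>2\<close> is integrable.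
\<close>

section \<open>Henstock--Kurzweil integrals on a half-line\<close>

lemma negligible_countable:
  fixes S :: "'a::euclidean_space set"
  assumes "countable S"
  shows "negligible S"
  using assms by (simp add: negligible_iff_null_sets countable_imp_null_set_lborel null_sets_completionI)

text \<open>Breakpoints of the highest derivative may accumulate at 0, and the half-line version
  below uses compact intervals that contain 0, so finitely many exceptions would not do.
  Integrability of \<open>f\<close> is a conclusion, as is typical of the Henstock-Kurzweil
  integral.\<close>

lemma fundamental_theorem_of_calculus_countable:
  fixes F :: "real \<Rightarrow> 'a::banach"
  assumes "countable S" and "a \<le> b" and cont: "continuous_on {a..b} F"
    and deriv: "\<And>x. x \<in> {a<..<b} - S \<Longrightarrow> (F has_vector_derivative f x) (at x)"
  shows "(f has_integral (F b - F a)) {a..b}"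
proof -
  \<comment> \<open>The end points join the exceptional set because the derivative is only given in
    the open interval. This also makes the set nonempty, as an enumeration by all naturals
    requires.\<close>
  define S' where "S' = S \<union> {a, b}"
  have "countable S'" using \<open>countable S\<close> by (simp add: S'_def)
  define s where "s = from_nat_into S'"
  have s: "range s = S'"
    unfolding s_def using \<open>countable S'\<close> by (intro range_from_nat_into) (auto simp: S'_def)
  text \<open>Weighting the k-th exceptional point by \<open>2\<^sup>-\<^sup>k\<close>, let \<open>\<phi>\<close> jump by its weight on either side of
    it. An interval tagged there then contributes an error bounded by an increment of \<open>\<phi>\<close>, and these
    increments telescope, so the intervals sharing a tag need not be counted.\<close>
  define w :: "nat \<Rightarrow> real" where "w = (\<lambda>k. (1/2) ^ k)"
  define t :: "real \<Rightarrow> nat \<Rightarrow> real"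
    where "t = (\<lambda>x k. w k * (of_bool (s k < x) + of_bool (s k \<le> x)))"
  have w_pos: "w k > 0" for k by (simp add: w_def)
  have w_sum: "summable (\<lambda>k. 2 * w k)" "(\<Sum>k. 2 * w k) = 4"
    unfolding w_def using suminf_geometric[of "1/2::real"]
    by (auto intro!: summable_mult simp: suminf_mult)
  have t_nonneg: "0 \<le> t x k" for x k
    using w_pos[of k] by (simp add: t_def)
  have t_le: "t x k \<le> 2 * w k" for x k
    using w_pos[of k] by (auto simp: t_def of_bool_def)
  have t_sum: "summable (t x)" for x
    by (rule summable_comparison_test'[OF w_sum(1), where N=0]) (use t_nonneg t_le in auto)
  have t_mono: "t x k \<le> t y k" if "x \<le> y" for x y k
    unfolding t_def using w_pos[of k] that by (intro mult_left_mono) (auto simp: of_bool_def)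
  define \<phi> where "\<phi> = (\<lambda>x. suminf (t x))"
  have \<phi>_diff: "\<phi> y - \<phi> x = (\<Sum>k. t y k - t x k)" for x y
    by (simp add: \<phi>_def suminf_diff t_sum)
  have \<phi>_mono: "\<phi> x \<le> \<phi> y" if "x \<le> y" for x y
    unfolding \<phi>_def using that by (intro suminf_le t_mono t_sum)
  have \<phi>_jump: "w k \<le> \<phi> y - \<phi> x" if "x < y" "x \<le> s k" "s k \<le> y" for x y k
  proof -
    have "w k \<le> t y k - t x k"
      using that w_pos[of k] by (auto simp: t_def of_bool_def)
    also have "\<dots> = (\<Sum>i\<in>{k}. t y i - t x i)" by simp
    also have "\<dots> \<le> (\<Sum>i. t y i - t x i)"
      using that t_mono by (intro sum_le_suminf) (auto intro: summable_diff t_sum)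
    finally show ?thesis by (simp add: \<phi>_diff)
  qed
  have "\<phi> b \<le> 4"
    unfolding \<phi>_def using w_sum by (metis suminf_le t_le t_sum)
  moreover have "0 \<le> \<phi> a"
    unfolding \<phi>_def by (intro suminf_nonneg t_sum t_nonneg)
  ultimately have \<phi>_bound: "\<phi> b - \<phi> a \<le> 4" by simp
  \<comment> \<open>\<open>f\<close> is arbitrary at exceptional points. With the value 0 there, the
    error of an interval tagged at such a point is just the increment of \<open>F\<close>, which
    continuity controls; the change is on a negligible set.\<close>
  define f0 where "f0 = (\<lambda>x. if x \<in> S' then 0 else f x)"
  have "(f0 has_integral (F b - F a)) {a..b}"
    unfolding has_integral_real
  proof safe
    fix e0 :: real assume "e0 > 0"
    \<comment> \<open>The total error will be at most \<open>e\<close> times the length plus the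
      increase of \<open>\<phi>\<close>, that is \<open>e * (b - a + 4)\<close>. The 5 makes this
      strictly smaller than \<open>e0\<close> and keeps the denominator positive when a = b.\<close>
    define e where "e = e0 / (b - a + 5)"
    have "e > 0" using \<open>e0 > 0\<close> \<open>a \<le> b\<close> by (simp add: e_def)
    have e_bound: "e * (b - a + 4) < e0"
      using \<open>e0 > 0\<close> \<open>a \<le> b\<close> by (simp add: e_def field_simps)
    have "\<exists>d>0. x \<in> {a..b} \<longrightarrow> (\<forall>u v. u \<in> {a..b} \<and> v \<in> {a..b} \<and> u \<le> x \<and> x \<le> v \<and>
              u \<in> ball x d \<and> v \<in> ball x d \<longrightarrow>
              norm ((v - u) *\<^sub>R f0 x - (F v - F u)) \<le> e * (v - u + (\<phi> v - \<phi> u)))" (is "\<exists>d>0. ?P x d") for x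
    proof (cases "x \<in> {a..b}")
      case True
      show ?thesis
      proof (cases "x \<in> S'")
        case True
        then obtain k where k: "s k = x" using s by (metis rangeE)
        have "e * w k / 2 > 0" using \<open>e > 0\<close> w_pos by simp
        then obtain d where d: "d > 0"
            "\<And>y. y \<in> {a..b} \<Longrightarrow> dist y x < d \<Longrightarrow> dist (F y) (F x) < e * w k / 2"
          using cont \<open>x \<in> {a..b}\<close> unfolding continuous_on_iff by metis
        show ?thesis
        proof (intro exI conjI impI allI)
          show "d > 0" by fact
          fix u v
          assume uv: "u \<in> {a..b} \<and> v \<in> {a..b} \<and> u \<le> x \<and> x \<le> v \<and> u \<in> ball x d \<and> v \<in> ball x d"
          show "norm ((v - u) *\<^sub>R f0 x - (F v - F u)) \<le> e * (v - u + (\<phi> v - \<phi> u))"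
          proof (cases "u = v")
            case False
            then have "w k \<le> \<phi> v - \<phi> u" using uv k by (intro \<phi>_jump) auto
            have "norm (F v - F u) \<le> dist (F u) (F x) + dist (F v) (F x)"
              by (metis dist_commute dist_norm dist_triangle2)
            also have "\<dots> \<le> e * w k"
              using d(2)[of u] d(2)[of v] uv by (auto simp: dist_commute)
            also have "\<dots> \<le> e * (v - u + (\<phi> v - \<phi> u))"
              using \<open>w k \<le> _\<close> \<open>e > 0\<close> uv by (intro mult_left_mono) auto
            finally show ?thesis using True by (simp add: f0_def norm_minus_commute)
          qed simp
        qed
      next
        case False
        then have "(F has_vector_derivative f x) (at x)"
          using True by (intro deriv) (auto simp: S'_def)
        then obtain d where d: "d > 0"
            "\<And>y. norm (y - x) < d \<Longrightarrow> norm (F y - F x - (y - x) *\<^sub>R f x) \<le> e * norm (y - x)"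
          using \<open>e > 0\<close> unfolding has_vector_derivative_def has_derivative_at_alt by metis
        show ?thesis
        proof (intro exI conjI impI allI)
          show "d > 0" by fact
          fix u v
          assume uv: "u \<in> {a..b} \<and> v \<in> {a..b} \<and> u \<le> x \<and> x \<le> v \<and> u \<in> ball x d \<and> v \<in> ball x d"
          have "norm ((v - u) *\<^sub>R f x - (F v - F u)) =
                norm (F u - F x - (u - x) *\<^sub>R f x - (F v - F x - (v - x) *\<^sub>R f x))"
            by (auto simp: algebra_simps)
          also have "\<dots> \<le> e * norm (u - x) + e * norm (v - x)"
            by (rule order_trans[OF norm_triangle_ineq4 add_mono])
               (use uv d(2)[of u] d(2)[of v] in \<open>auto simp: dist_real_def\<close>)
          also have "\<dots> = e * (v - u)" using uv by (simp add: algebra_simps)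
          also have "\<dots> \<le> e * (v - u + (\<phi> v - \<phi> u))"
            using \<open>e > 0\<close> uv \<phi>_mono[of u v] by (intro mult_left_mono) auto
          finally show "norm ((v - u) *\<^sub>R f0 x - (F v - F u)) \<le> e * (v - u + (\<phi> v - \<phi> u))"
            using False by (simp add: f0_def)
        qed
      qed
    qed (auto intro: exI[of _ 1])
    then obtain d where d_pos: "\<And>x. d x > 0" and d: "\<And>x. ?P x (d x)" by metis
    show "\<exists>\<gamma>. gauge \<gamma> \<and> (\<forall>p. p tagged_division_of {a..b} \<and> \<gamma> fine p \<longrightarrow>
            norm ((\<Sum>(x, K)\<in>p. measure lborel K *\<^sub>R f0 x) - (F b - F a)) < e0)"
    proof (rule exI, safe)
      show "gauge (\<lambda>x. ball x (d x))" using d_pos gauge_ball_dependent by blast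
      fix p assume p: "p tagged_division_of {a..b}" and fine: "(\<lambda>x. ball x (d x)) fine p"
      have "(\<Sum>(x, K)\<in>p. measure lborel K *\<^sub>R f0 x) - (F b - F a) =
            (\<Sum>(x, K)\<in>p. measure lborel K *\<^sub>R f0 x - (F (Sup K) - F (Inf K)))"
        using additive_tagged_division_1[OF \<open>a \<le> b\<close> p, of F]
        by (simp add: split_def sum_subtractf)
      also have "norm \<dots> \<le> (\<Sum>(x, K)\<in>p. e * (Sup K - Inf K + (\<phi> (Sup K) - \<phi> (Inf K))))"
      proof (rule sum_norm_le, safe)
        fix x K assume K: "(x, K) \<in> p"
        obtain u v where uv: "K = {u..v}"
          using tagged_division_ofD(4)[OF p K] by (auto simp: box_real)
        have x: "x \<in> K" "K \<subseteq> {a..b}" "K \<subseteq> ball x (d x)"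
          using tagged_division_ofD(2,3)[OF p K] fine K by (auto simp: fine_def)
        then have "u \<le> v" by (simp add: uv)
        then have "u \<in> K" "v \<in> K" by (simp_all add: uv)
        with x have "norm ((v - u) *\<^sub>R f0 x - (F v - F u)) \<le> e * (v - u + (\<phi> v - \<phi> u))"
          using d[of x] unfolding uv by (auto simp: subset_iff)
        then show "norm (measure lborel K *\<^sub>R f0 x - (F (Sup K) - F (Inf K)))
               \<le> e * (Sup K - Inf K + (\<phi> (Sup K) - \<phi> (Inf K)))"
          using \<open>u \<le> v\<close> by (simp add: uv)
      qed
      also have "\<dots> = e * ((b - a) + (\<phi> b - \<phi> a))"
        using additive_tagged_division_1[OF \<open>a \<le> b\<close> p, of "\<lambda>x. x"]
          additive_tagged_division_1[OF \<open>a \<le> b\<close> p, of \<phi>]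
        by (simp add: split_def sum.distrib flip: sum_distrib_left)
      also have "\<dots> \<le> e * (b - a + 4)"
        using \<phi>_bound \<open>e > 0\<close> by simp
      finally show "norm ((\<Sum>(x, K)\<in>p. measure lborel K *\<^sub>R f0 x) - (F b - F a)) < e0"
        using e_bound by simp
    qed
  qed
  moreover have "negligible S'" using \<open>countable S'\<close> by (rule negligible_countable)
  ultimately show ?thesis
    by (rule has_integral_spike[rotated 2]) (auto simp: f0_def)
qed

section \<open>Integrability and the fundamental theorem on half-open intervals and
  half-lines\<close>

lemma integrable_on_Ioc_iff:
  fixes h :: "real \<Rightarrow> 'a::banach"
  assumes "a \<le> b"
  shows "h integrable_on {a<..b} \<longleftrightarrow> h integrable_on {a..b}"
proof -
  have "{a..b} = insert a {a<..b}" using assms by auto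
  then show ?thesis by (simp add: integrable_on_insert_iff)
qed

lemma continuous_on_extend_at_right:
  fixes F :: "real \<Rightarrow> 'a::topological_space"
  assumes "continuous_on {a<..} F" and "(F \<longlongrightarrow> l) (at_right a)"
  shows "continuous_on {a..} (\<lambda>x. if x \<le> a then l else F x)" (is "continuous_on _ ?G")
proof -
  have "(?G \<longlongrightarrow> ?G x) (at x within {a..})" if "x \<ge> a" for x
  proof (cases "x = a")
    case True
    have "(?G \<longlongrightarrow> l) (at_right a)"
      using assms(2) by (rule Lim_transform_eventually)
        (auto intro: eventually_mono[OF eventually_at_right_less])
    moreover have "at a within {a..} = at_right a"
      by (rule at_within_Ici_at_right) 
    ultimately show ?thesis using True by simp
  next
    case False
    then have "x > a" using that by simp
    then have "(F \<longlongrightarrow> F x) (at x)"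
      using assms(1) by (auto simp: continuous_on_eq_continuous_at isCont_def)
    then have "(?G \<longlongrightarrow> F x) (at x)"
      by (rule Lim_transform_within_open[where s = "{a<..}"]) (use \<open>x > a\<close> in auto)
    then show ?thesis using \<open>x > a\<close> by (auto intro: tendsto_within_subset)
  qed
  then show ?thesis by (auto simp: continuous_on_def)
qed

lemma integrable_on_Ioc_of_tendsto:
  fixes h :: "real \<Rightarrow> 'a::banach"
  assumes "continuous_on {a<..} h" and "(h \<longlongrightarrow> l) (at_right a)" and "a \<le> c"
  shows "h integrable_on {a<..c}"
proof -
  let ?h = "\<lambda>x. if x \<le> a then l else h x"
  have "?h integrable_on {a..c}"
    using continuous_on_extend_at_right[OF assms(1,2)]
    by (intro integrable_continuous_real) (auto elim: continuous_on_subset)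
  then have "?h integrable_on {a<..c}" using \<open>a \<le> c\<close> by (simp add: integrable_on_Ioc_iff)
  then show ?thesis by (rule integrable_eq) auto
qed

lemma integrable_on_Ioc_subset:
  fixes h :: "real \<Rightarrow> 'a::banach"
  assumes "h integrable_on {a<..c}" and "a \<le> b" and "b \<le> c"
  shows "h integrable_on {a<..b}"
  using assms by (auto simp: integrable_on_Ioc_iff elim: integrable_subinterval_real)

text \<open>The two ends are treated differently: near \<open>a\<close> the integral may converge
  only conditionally and is assumed to exist, whereas the tail is dominated by an
  exponential.\<close>

lemma integrable_on_Ioi_of_exp_decay:
  fixes h :: "real \<Rightarrow> 'a::euclidean_space"
  assumes cont: "continuous_on {a<..} h" and c: "a < c" "h integrable_on {a<..c}"
    and decay: "\<delta> > 0" "\<And>x. x \<ge> X \<Longrightarrow> norm (h x) \<le> C * exp (- \<delta> * x)"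
  shows "h integrable_on {a<..}"
proof -
  define d where "d = max c X"
  have "h integrable_on {c..d}"
    using c by (intro integrable_continuous_real continuous_on_subset[OF cont]) auto
  with c(2) have "h integrable_on {a<..d}"
    by (rule integrable_Un')
       (use \<open>a < c\<close> in \<open>auto simp: d_def intro: negligible_subset[of "{c}"]\<close>)
  moreover have "h integrable_on {d..}"
  proof (rule measurable_bounded_by_integrable_imp_integrable)
    show "h \<in> borel_measurable (lebesgue_on {d..})"
      using c by (intro continuous_imp_measurable_on_sets_lebesgue continuous_on_subset[OF cont])
                 (auto simp: d_def)
    show "(\<lambda>x. C * exp (- \<delta> * x)) integrable_on {d..}"
      using integrable_on_exp_minus_to_infinity[OF \<open>\<delta> > 0\<close>] by (rule integrable_on_mult_right)
  qed (auto simp: d_def intro!: decay(2)[simplified])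
  ultimately show ?thesis
    by (rule integrable_Un')
       (use \<open>a < c\<close> in \<open>auto simp: d_def intro: negligible_subset[of "{d}"]\<close>)
qed

text \<open>The two limits of \<open>F\<close> alone make the improper integral converge, possibly
  conditionally.\<close>

lemma fundamental_theorem_of_calculus_Ioi:
  fixes F :: "real \<Rightarrow> 'a::banach"
  assumes "countable S" and cont: "continuous_on {a<..} F"
    and deriv: "\<And>x. x \<in> {a<..} - S \<Longrightarrow> (F has_vector_derivative f x) (at x)"
    and l: "(F \<longlongrightarrow> l) (at_right a)" and L: "(F \<longlongrightarrow> L) at_top"
  shows "(f has_integral (L - l)) {a<..}"
proof -
  \<comment> \<open>Continued to the left by its limit, \<open>F\<close> becomes an antiderivative
    on the whole line of \<open>f\<close> extended by 0, with \<open>a\<close> as one more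
    exceptional point. The compact version then covers every interval.\<close>
  let ?G = "\<lambda>x. if x \<le> a then l else F x"
  let ?f = "\<lambda>x. if x \<in> {a<..} then f x else 0"
  have "(?f has_integral (?G q - ?G p)) {p..q}" if "p \<le> q" for p q
  proof (rule fundamental_theorem_of_calculus_countable[where S = "insert a S"])
    have "continuous_on ({a..} \<union> {..a}) ?G"
    proof (rule continuous_on_closed_Un)
      show "continuous_on {a..} ?G" by (rule continuous_on_extend_at_right[OF cont l])
      have "continuous_on {..a} (\<lambda>_. l)" by simp
      then show "continuous_on {..a} ?G" by (rule continuous_on_eq) simp
    qed auto
    moreover have "{p..q} \<subseteq> {a..} \<union> {..a}" by (meson Un_iff atLeast_iff atMost_iff linear subsetI)
    ultimately show "continuous_on {p..q} ?G" by (rule continuous_on_subset)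
    fix x assume x: "x \<in> {p<..<q} - insert a S"
    show "(?G has_vector_derivative ?f x) (at x)"
    proof (cases "x < a")
      case True
      have "((\<lambda>_. l) has_vector_derivative 0) (at x)" by simp
      then have "(?G has_vector_derivative 0) (at x)"
        by (rule has_vector_derivative_transform_within_open[where S = "{..<a}"]) (use True in auto)
      then show ?thesis using True by simp
    next
      case False
      then have "(?G has_vector_derivative f x) (at x)"
        by (intro has_vector_derivative_transform_within_open[where S = "{a<..}", OF deriv])
           (use x in auto)
      then show ?thesis using False x by simp
    qed
  qed (use \<open>countable S\<close> that in auto)
  note * = this
  show ?thesis
    unfolding has_integral_alt'
  proof safe
    show "?f integrable_on cbox p q" for p q
      using *[of p q] by (cases "p \<le> q") auto
    fix e :: real assume "e > 0"
    then obtain N where N: "\<And>x. x \<ge> N \<Longrightarrow> dist (F x) L < e"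
      using L by (auto simp: tendsto_iff eventually_at_top_linorder)
    \<comment> \<open>An interval containing the ball of this radius starts to the left of
      \<open>a\<close> and ends to the right of both \<open>a\<close> and \<open>N\<close>.\<close>
    define B where "B = \<bar>a\<bar> + \<bar>N\<bar> + 1"
    show "\<exists>B>0. \<forall>p q. ball 0 B \<subseteq> cbox p q \<longrightarrow> norm (integral (cbox p q) ?f - (L - l)) < e"
    proof (intro exI conjI allI impI)
      show "B > 0" by (simp add: B_def)
      fix p q :: real assume "ball 0 B \<subseteq> cbox p q"
      then have "{-B..B} \<subseteq> {p..q}"
        using \<open>B > 0\<close> closure_mono[of "ball 0 B" "cbox p q"] by (auto simp: cball_eq_atLeastAtMost)
      then have pq: "p \<le> - B" "B \<le> q" using \<open>B > 0\<close> by auto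
      then have "p \<le> a" "\<not> q \<le> a" "p \<le> q" by (auto simp: B_def)
      then have "integral {p..q} ?f = F q - l"
        using *[of p q] by (simp add: integral_unique)
      then show "norm (integral (cbox p q) ?f - (L - l)) < e"
        using N[of q] pq by (simp add: B_def dist_norm)
    qed
  qed
qed

section \<open>Possibly conditional convergence at the left end point\<close>

text \<open>Multiplying by a bounded or even continuous function can destroy conditional
  convergence; a monotone factor is safe, since the second mean value theorem includes existence of
  the integral of the product. That theorem is for real functions, hence the components.\<close>

lemma integrable_monotone_mult:
  fixes f :: "real \<Rightarrow> 'a::euclidean_space" and g :: "real \<Rightarrow> real"
  assumes f: "f integrable_on {a..b}" and g: "mono_on {a..b} g"
  shows "(\<lambda>x. g x *\<^sub>R f x) integrable_on {a..b}"
proof (cases "a \<le> b")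
  case True
  show ?thesis
  proof (subst integrable_componentwise_iff, intro ballI)
    fix i :: 'a
    have "(\<lambda>x. f x \<bullet> i) integrable_on {a..b}" using f by (rule integrable_component)
    moreover have "g x \<le> g y" if "a \<le> x" "x \<le> y" "y \<le> b" for x y
      using that by (intro monotone_onD[OF g]) auto
    ultimately obtain I where "((\<lambda>x. g x * (f x \<bullet> i)) has_integral I) {a..b}"
      using second_mean_value_theorem_full[OF _ True] by blast
    then show "(\<lambda>x. (g x *\<^sub>R f x) \<bullet> i) integrable_on {a..b}" by (auto simp: integrable_on_def)
  qed
qed (auto intro: integrable_on_empty)

text \<open>Near \<open>a\<close>, F(x) is F(c) minus the integral of \<open>f\<close> over [x, c],
  and an indefinite Henstock-Kurzweil integral is continuous up to the end point even when
  convergence there is conditional.\<close>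

lemma tendsto_at_right_of_integrable_derivative:
  fixes F :: "real \<Rightarrow> 'a::banach"
  assumes "countable S" and cont: "continuous_on {a<..} F"
    and deriv: "\<And>x. x \<in> {a<..} - S \<Longrightarrow> (F has_vector_derivative f x) (at x)"
    and int: "f integrable_on {a<..c}" and "a < c"
  shows "\<exists>l. (F \<longlongrightarrow> l) (at_right a)"
proof -
  have int': "f integrable_on {a..c}" using int \<open>a < c\<close> by (simp add: integrable_on_Ioc_iff)
  have "((\<lambda>x. integral {x..c} f) \<longlongrightarrow> integral {a..c} f) (at_right a)"
    using indefinite_integral_continuous_1'[OF int'] \<open>a < c\<close>
    by (auto simp: continuous_on_def at_within_Icc_at_right[symmetric])
  then have "((\<lambda>x. F c - integral {x..c} f) \<longlongrightarrow> F c - integral {a..c} f) (at_right a)"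
    by (intro tendsto_intros)
  moreover have "\<forall>\<^sub>F x in at_right a. F c - integral {x..c} f = F x"
    using eventually_at_right_real[OF \<open>a < c\<close>]
  proof eventually_elim
    case (elim x)
    then have "(f has_integral (F c - F x)) {x..c}"
      by (intro fundamental_theorem_of_calculus_countable[OF \<open>countable S\<close>] continuous_on_subset[OF cont] deriv)
         auto
    then show ?case by (simp add: integral_unique)
  qed
  ultimately show ?thesis by (blast intro: Lim_transform_eventually)
qed

lemma not_integrable_inverse_square:
  fixes c :: real
  assumes "c > 0" shows "\<not> (\<lambda>x. 1 / x ^ 2) integrable_on {0<..c}"
proof
  assume *: "(\<lambda>x. 1 / x ^ 2 :: real) integrable_on {0<..c}"
  define I where "I = integral {0<..c} (\<lambda>x. 1 / x ^ 2 :: real)"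
  have "1 / e - 1 / c \<le> I" if "0 < e" "e \<le> c" for e
  proof -
    have "((\<lambda>x. 1 / x ^ 2) has_integral ((- 1 / c) - (- 1 / e))) {e..c}"
      using that
      by (intro fundamental_theorem_of_calculus)
         (auto intro!: derivative_eq_intros simp: power2_eq_square
            simp flip: has_real_derivative_iff_has_vector_derivative)
    moreover from this have "integral {e..c} (\<lambda>x. 1 / x ^ 2) \<le> I"
      unfolding I_def using that by (intro integral_subset_le * ) auto
    ultimately show ?thesis by (simp add: integral_unique)
  qed
  \<comment> \<open>For this \<open>e\<close> the lower bound 1/e - 1/c equals |I| + 1, which
    exceeds \<open>I\<close>.\<close>
  moreover define e where "e = 1 / (1 / c + \<bar>I\<bar> + 1)"
  moreover have "0 < 1 / c" "1 / e = 1 / c + \<bar>I\<bar> + 1" using assms by (simp_all add: e_def)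
  moreover from this have "0 < e" by (simp add: e_def add_pos_nonneg)
  moreover have "e \<le> 1 / (1 / c)"
    unfolding e_def using assms by (intro divide_left_mono mult_pos_pos) (auto simp: add_pos_nonneg)
  then have "e \<le> c" by simp
  ultimately show False by fastforce
qed

text \<open>Were \<open>l\<close> nonzero, the real part of F(x) cnj(l) would exceed |l|^2/2 near 0,
  giving 1/x^2 an integrable majorant. Using a real part instead of the norm allows for a merely
  conditionally convergent integral.\<close>

lemma tendsto_0_of_integrable_divide_square:
  fixes F :: "real \<Rightarrow> complex"
  assumes lim: "(F \<longlongrightarrow> l) (at_right 0)" and "c > 0"
    and int: "(\<lambda>x. F x / of_real (x ^ 2)) integrable_on {0<..c}"
  shows "l = 0"
proof (rule ccontr)
  assume "l \<noteq> 0"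
  have "((\<lambda>x. Re (F x * cnj l)) \<longlongrightarrow> Re (l * cnj l)) (at_right 0)"
    by (intro tendsto_intros lim)
  moreover have "Re (l * cnj l) > (norm l)^2 / 2"
    using \<open>l \<noteq> 0\<close> by (simp add: complex_norm_square[symmetric])
  ultimately have "\<forall>\<^sub>F x in at_right 0. Re (F x * cnj l) > (norm l)^2 / 2"
    by (rule order_tendstoD(1))
  then obtain d where d: "d > 0" "\<And>x. 0 < x \<Longrightarrow> x < d \<Longrightarrow> Re (F x * cnj l) > (norm l)^2 / 2"
    by (auto simp: eventually_at_right_field)
  define b where "b = min c (d / 2)"
  have b: "0 < b" "b \<le> c" "b < d" using \<open>c > 0\<close> \<open>d > 0\<close> by (auto simp: b_def)
  let ?h = "\<lambda>x. 2 / (norm l)^2 * Re (F x / of_real (x ^ 2) * cnj l)"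
  have "(\<lambda>x. F x / of_real (x ^ 2)) integrable_on {0<..b}"
    using int b by (auto intro: integrable_on_Ioc_subset)
  then have "(\<lambda>x. F x / of_real (x ^ 2) * cnj l) integrable_on {0<..b}"
    by (rule integrable_on_mult_left)
  then have "(Re \<circ> (\<lambda>x. F x / of_real (x ^ 2) * cnj l)) integrable_on {0<..b}"
    by (rule integrable_linear[OF _ bounded_linear_Re])
  then have h: "?h integrable_on {0<..b}"
    unfolding o_def by (rule integrable_on_mult_right)
  have h_ge: "norm (1 / x ^ 2) \<le> ?h x" if "x \<in> {0<..b}" for x
    using d(2)[of x] that b \<open>l \<noteq> 0\<close> 
    by (simp add: field_simps Re_divide_of_real)
  have "(\<lambda>x. 1 / x ^ 2 :: real) integrable_on {0<..b}"
  proof (rule measurable_bounded_by_integrable_imp_integrable[OF _ h h_ge])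
    show "(\<lambda>x. 1 / x ^ 2 :: real) \<in> borel_measurable (lebesgue_on {0<..b})"
      by (intro continuous_imp_measurable_on_sets_lebesgue continuous_intros) auto
  qed auto
  then show False using not_integrable_inverse_square[OF \<open>0 < b\<close>] by blast
qed

section \<open>The integrand of the transform\<close>

lemma pow_add_pow_not_nonpos_Reals:
  fixes x \<omega> :: real
  assumes "x > 0" "\<omega> > 0"
  shows "(of_real x :: complex) ^ m + of_real \<omega> ^ m \<notin> \<real>\<^sub>\<le>\<^sub>0"
proof -
  have "x ^ m + \<omega> ^ m > 0" using assms by (simp add: add_pos_pos)
  moreover have "(of_real x :: complex) ^ m + of_real \<omega> ^ m = of_real (x ^ m + \<omega> ^ m)" by simp
  ultimately show ?thesis by (metis complex_nonpos_Reals_iff Re_complex_of_real not_less)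
qed

text \<open>The product rule in terms of transforms. The exponent -v/x contributes v/x^2 = v omega^2
  (omega x)^(-2). The denominator contributes -m rho x^(m-1)/(x^m + omega^m), which raises the
  exponent to rho + 1; rewriting x^(m-1) in omega x costs the factor omega^(m-1).\<close>

lemma M_integrand_has_vector_derivative:
  assumes "x > 0" "\<omega> > 0" and g: "(g has_vector_derivative g' (\<omega> * x)) (at (\<omega> * x))"
  shows "(M_integrand \<rho> m g u v \<omega> has_vector_derivative
      of_real \<omega> * M_integrand \<rho> m g' u v \<omega> x - u * M_integrand \<rho> m g u v \<omega> x
      + v * of_real \<omega> ^ 2 * M_integrand \<rho> m (\<lambda>x. of_real (x powi (-2)) * g x) u v \<omega> x
      - of_nat m * \<rho> / of_real \<omega> ^ (m - 1) *
          M_integrand (\<rho> + 1) m (\<lambda>x. of_real (x ^ (m - 1)) * g x) u v \<omega> x) (at x)"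
proof -
  \<comment> \<open>Extended to a complex variable, the kernel obeys the complex differentiation
    rules; the derivative along the reals follows by restriction.\<close>
  define k :: "complex \<Rightarrow> complex" where
    "k = (\<lambda>z. exp (- u * z - v / z) / (z ^ m + of_real \<omega> ^ m) powr \<rho>)"
  define z :: complex where "z = of_real x"
  define q where "q = z ^ m + of_real \<omega> ^ m"
  have q: "q \<notin> \<real>\<^sub>\<le>\<^sub>0"
    using pow_add_pow_not_nonpos_Reals[OF assms(1,2)] by (simp add: q_def z_def)
  then have "q \<noteq> 0" by auto
  have "z \<noteq> 0" using \<open>x > 0\<close> by (simp add: z_def)
  have E: "((\<lambda>z. exp (- u * z - v / z)) has_field_derivative
      exp (- u * z - v / z) * (- u + v / z ^ 2)) (at z)"
    using \<open>z \<noteq> 0\<close> by (auto intro!: derivative_eq_intros simp: field_simps power2_eq_square)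
  have D: "((\<lambda>z. (z ^ m + of_real \<omega> ^ m) powr \<rho>) has_field_derivative
      q powr \<rho> * (\<rho> * of_nat m * z ^ (m - 1) / q)) (at z)"
    using q \<open>q \<noteq> 0\<close> unfolding q_def by (auto intro!: derivative_eq_intros simp: powr_diff)
  have k_deriv: "(k has_field_derivative
      (k z * (- u + v / z ^ 2 - \<rho> * of_nat m * z ^ (m - 1) / q))) (at z)"
  proof -
    have alg: "(e * a * d - e * (d * b)) / (d * d) = e / d * (a - b)" if "d \<noteq> 0" for e a b d :: complex
      using that by (simp add: field_simps)
    have "(z ^ m + of_real \<omega> ^ m) powr \<rho> \<noteq> 0"
      using \<open>q \<noteq> 0\<close> by (simp add: q_def)
    from DERIV_divide[OF E D this] alg[OF this] show ?thesis
      unfolding k_def q_def by (metis (no_types, lifting))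
  qed
  have "((\<lambda>x. k (of_real x)) has_vector_derivative
      (k z * (- u + v / z ^ 2 - \<rho> * of_nat m * z ^ (m - 1) / q))) (at x)"
    using k_deriv unfolding z_def by (rule has_vector_derivative_real_field)
  moreover have "((\<lambda>x. g (\<omega> * x)) has_vector_derivative \<omega> *\<^sub>R g' (\<omega> * x)) (at x)"
  proof -
    have "((\<lambda>x. \<omega> * x) has_vector_derivative \<omega>) (at x)"
      by (auto intro!: derivative_eq_intros simp flip: has_real_derivative_iff_has_vector_derivative)
    from vector_diff_chain_at[OF this g] show ?thesis by (simp add: o_def)
  qed
  ultimately have "((\<lambda>x. k (of_real x) * g (\<omega> * x)) has_vector_derivative
      (k z * (\<omega> *\<^sub>R g' (\<omega> * x)) +
       k z * (- u + v / z ^ 2 - \<rho> * of_nat m * z ^ (m - 1) / q) * g (\<omega> * x))) (at x)"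
    unfolding z_def by (rule has_vector_derivative_mult)
  moreover have "M_integrand \<rho> m g u v \<omega> = (\<lambda>x. k (of_real x) * g (\<omega> * x))" for g
    by (simp add: M_integrand_def k_def fun_eq_iff)
  moreover have "M_integrand (\<rho> + 1) m h u v \<omega> x = k z / q * h (\<omega> * x)" for h
    using \<open>q \<noteq> 0\<close> by (simp add: M_integrand_def k_def powr_add q_def z_def)
  moreover have "of_real ((\<omega> * x) powi (-2)) = 1 / (of_real \<omega> ^ 2 * z ^ 2)"
    by (simp add: power_int_minus z_def power_mult_distrib field_simps)
  moreover have "of_real ((\<omega> * x) ^ (m - 1)) = of_real \<omega> ^ (m - 1) * z ^ (m - 1)"
    by (simp add: z_def power_mult_distrib)
  ultimately show ?thesis
    using \<open>\<omega> > 0\<close> \<open>z \<noteq> 0\<close> \<open>q \<noteq> 0\<close> 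
    by (simp add: scaleR_conv_of_real z_def[symmetric] algebra_simps)
qed

text \<open>The integrand evaluates \<open>g\<close> at omega x, so its exceptional points are those
  of \<open>g\<close> divided by omega.\<close>

lemma M_integrand_has_vector_derivative_off:
  assumes "\<omega> > 0" and x: "x \<in> {0<..} - (\<lambda>x. x / \<omega>) ` P"
    and "\<And>x. x \<in> {0<..} - P \<Longrightarrow> (g has_vector_derivative g' x) (at x)"
  shows "(M_integrand \<rho> m g u v \<omega> has_vector_derivative
      of_real \<omega> * M_integrand \<rho> m g' u v \<omega> x - u * M_integrand \<rho> m g u v \<omega> x
      + v * of_real \<omega> ^ 2 * M_integrand \<rho> m (\<lambda>x. of_real (x powi (-2)) * g x) u v \<omega> x
      - of_nat m * \<rho> / of_real \<omega> ^ (m - 1) *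
          M_integrand (\<rho> + 1) m (\<lambda>x. of_real (x ^ (m - 1)) * g x) u v \<omega> x) (at x)"
proof -
  have "\<omega> * x \<notin> P"
  proof
    assume "\<omega> * x \<in> P"
    then have "\<omega> * x / \<omega> \<in> (\<lambda>x. x / \<omega>) ` P" by (rule imageI)
    with x \<open>\<omega> > 0\<close> show False by simp
  qed
  with assms show ?thesis by (intro M_integrand_has_vector_derivative) auto
qed

lemma M_integrand_inverse_square:
  "M_integrand \<rho> m (\<lambda>x. of_real (x powi (-2)) * g x) u v \<omega> x =
    of_real ((\<omega> * x) powi (-2)) * M_integrand \<rho> m g u v \<omega> x"
  by (simp add: M_integrand_def)

lemma M_integrand_eq_square_mult:
  assumes "x > 0" "\<omega> > 0"
  shows "M_integrand \<rho> m g u v \<omega> x = of_real ((\<omega> * x) ^ 2) *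
    M_integrand \<rho> m (\<lambda>x. of_real (x powi (-2)) * g x) u v \<omega> x"
  unfolding M_integrand_inverse_square using assms by (simp add: power_int_minus)

lemma M_integrand_Suc_exponent:
  assumes "x > 0" "\<omega> > 0"
  shows "M_integrand (\<rho> + 1) m (\<lambda>x. of_real (x ^ (m - 1)) * g x) u v \<omega> x =
    of_real ((\<omega> * x) ^ (m - 1) / (x ^ m + \<omega> ^ m)) * M_integrand \<rho> m g u v \<omega> x"
proof -
  have "x ^ m + \<omega> ^ m > 0" using assms by (simp add: add_pos_pos)
  then have "(of_real x ^ m + of_real \<omega> ^ m :: complex) \<noteq> 0"
    by (metis of_real_add of_real_eq_0_iff of_real_power less_irrefl)
  then show ?thesis by (simp add: M_integrand_def powr_add field_simps)
qed

section \<open>Continuity of the integrand and decay at infinity\<close>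

lemma continuous_on_M_integrand:
  assumes "\<omega> > 0" "continuous_on {0<..} g"
  shows "continuous_on {0<..} (M_integrand \<rho> m g u v \<omega>)"
proof -
  have *: "of_real (x ^ m + \<omega> ^ m) \<notin> (\<real>\<^sub>\<le>\<^sub>0 :: complex set)" if "x \<in> {0<..}" for x
    using pow_add_pow_not_nonpos_Reals[of x \<omega> m] that assms(1) by simp
  then have "complex_of_real (x ^ m + \<omega> ^ m) \<noteq> 0" if "x \<in> {0<..}" for x
    using that by force
  with * show ?thesis
    unfolding M_integrand_def using assms(1)
    by (intro continuous_intros continuous_on_compose2[OF assms(2)]) (auto simp: powr_eq_0_iff)
qed

text \<open>The base x^m + omega^m is a positive real, so its power has modulus at least x^(m Re
  rho), which cancels the polynomial growth allowed to \<open>g\<close>. Since x >= X/omega, the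
  factor from v/x is at most exp(|v| omega / X), whatever the sign of Re v. An exponential of rate
  Re u - omega/beta remains.\<close>

lemma norm_M_integrand_le:
  assumes "\<omega> > 0" "X > 0" "Re \<rho> > 0" "K \<ge> 0" and x: "x \<ge> X / \<omega>"
    and g: "\<And>x. x \<ge> X \<Longrightarrow> norm (g x) \<le> K * x powr (real m * Re \<rho>) * exp (x / \<beta>)"
  shows "norm (M_integrand \<rho> m g u v \<omega> x) \<le>
    exp (norm v * \<omega> / X) * \<omega> powr (real m * Re \<rho>) * K * exp (- (Re u - \<omega> / \<beta>) * x)"
proof -
  have "x > 0" using assms by (meson divide_pos_pos less_le_trans)
  have "X \<le> \<omega> * x" using assms by (simp add: field_simps)
  define q where "q = x ^ m + \<omega> ^ m"
  have q: "q > 0" "x ^ m \<le> q" using \<open>x > 0\<close> \<open>\<omega> > 0\<close> by (simp_all add: q_def add_pos_pos)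
  have "norm (exp (- u * of_real x - v / of_real x)) \<le> exp (norm v * \<omega> / X) * exp (- Re u * x)"
  proof -
    have "- Re (v / of_real x) \<le> norm (v / of_real x)"
      by (metis abs_Re_le_cmod abs_le_D2)
    also have "\<dots> = norm v / x" using \<open>x > 0\<close> by (simp add: norm_divide)
    also have "\<dots> \<le> norm v / (X / \<omega>)"
      using x assms \<open>x > 0\<close> by (intro divide_left_mono) auto
    finally show ?thesis by (simp flip: exp_add)
  qed
  moreover have norm_q: "norm (of_real q powr \<rho>) = q powr Re \<rho>"
    using q by (simp add: norm_powr_real_powr)
  moreover have "norm (g (\<omega> * x)) \<le> K * (\<omega> powr (real m * Re \<rho>) * q powr Re \<rho>) * exp (\<omega> * x / \<beta>)"
  proof -
    have "(\<omega> * x) powr (real m * Re \<rho>) = \<omega> powr (real m * Re \<rho>) * (x ^ m) powr Re \<rho>"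
      using \<open>x > 0\<close> \<open>\<omega> > 0\<close> by (simp add: powr_mult powr_powr flip: powr_realpow)
    also have "\<dots> \<le> \<omega> powr (real m * Re \<rho>) * q powr Re \<rho>"
      using q \<open>x > 0\<close> \<open>Re \<rho> > 0\<close> by (intro mult_left_mono powr_mono2) auto
    finally show ?thesis
      using g[OF \<open>X \<le> \<omega> * x\<close>] \<open>K \<ge> 0\<close>
      by (elim order_trans) (intro mult_right_mono mult_left_mono, auto)
  qed
  ultimately have "norm (M_integrand \<rho> m g u v \<omega> x) \<le>
      (exp (norm v * \<omega> / X) * exp (- Re u * x)) / q powr Re \<rho> *
      (K * (\<omega> powr (real m * Re \<rho>) * q powr Re \<rho>) * exp (\<omega> * x / \<beta>))"
    unfolding M_integrand_def q_def[symmetric] norm_mult norm_divide norm_q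
    by (intro mult_mono divide_right_mono) auto
  also have "\<dots> = exp (norm v * \<omega> / X) * \<omega> powr (real m * Re \<rho>) * K *
      (exp (- Re u * x) * exp (\<omega> * x / \<beta>))"
    using q by (simp add: field_simps)
  also have "exp (- Re u * x) * exp (\<omega> * x / \<beta>) = exp (- (Re u - \<omega> / \<beta>) * x)"
    by (simp add: algebra_simps flip: exp_add)
  finally show ?thesis .
qed

text \<open>At infinity convergence is absolute, so only the lower limit needs an assumption. The
  second and third integrands are the first times (omega x)^(-2) and (omega x)^(m-1)/(x^m +
  omega^m), both bounded for x >= X/omega.\<close>

lemma M_converges_of_exp_growth:
  assumes "\<omega> > 0" "X > 0" "Re \<rho> > 0" "K \<ge> 0" "m \<ge> 1" "Re u > \<omega> / \<beta>"
    and cont: "continuous_on {0<..} g"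
    and g: "\<And>x. x \<ge> X \<Longrightarrow> norm (g x) \<le> K * x powr (real m * Re \<rho>) * exp (x / \<beta>)"
  shows "M_converges_at_0 \<rho> m g u v \<omega> \<Longrightarrow> M_converges \<rho> m g u v \<omega>"
    and "M_converges_at_0 \<rho> m (\<lambda>x. of_real (x powi (-2)) * g x) u v \<omega> \<Longrightarrow>
         M_converges \<rho> m (\<lambda>x. of_real (x powi (-2)) * g x) u v \<omega>"
    and "M_converges_at_0 (\<rho> + 1) m (\<lambda>x. of_real (x ^ (m - 1)) * g x) u v \<omega> \<Longrightarrow>
         M_converges (\<rho> + 1) m (\<lambda>x. of_real (x ^ (m - 1)) * g x) u v \<omega>"
    and "(M_integrand \<rho> m g u v \<omega> \<longlongrightarrow> 0) at_top"
proof -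
  define C where "C = exp (norm v * \<omega> / X) * \<omega> powr (real m * Re \<rho>) * K"
  define \<delta> where "\<delta> = Re u - \<omega> / \<beta>"
  have "\<delta> > 0" using assms by (simp add: \<delta>_def)
  have pos: "x > 0" if "x \<ge> X / \<omega>" for x
    using that assms by (meson divide_pos_pos less_le_trans)
  have W: "norm (M_integrand \<rho> m g u v \<omega> x) \<le> C * exp (- \<delta> * x)" if "x \<ge> X / \<omega>" for x
    unfolding C_def \<delta>_def by (rule norm_M_integrand_le[OF assms(1-4) that g])
  have conv: "M_converges \<rho>' m h u v \<omega>"
    if h: "continuous_on {0<..} h" "M_converges_at_0 \<rho>' m h u v \<omega>"
      "\<And>x. x \<ge> X / \<omega> \<Longrightarrow> norm (M_integrand \<rho>' m h u v \<omega> x) \<le> C' * norm (M_integrand \<rho> m g u v \<omega> x)"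
      "C' \<ge> 0" for \<rho>' h C'
  proof -
    obtain c where c: "c > 0" "M_integrand \<rho>' m h u v \<omega> integrable_on {0<..c}"
      using h(2) by (auto simp: M_converges_at_0_def)
    have "norm (M_integrand \<rho>' m h u v \<omega> x) \<le> C' * C * exp (- \<delta> * x)" if "x \<ge> X / \<omega>" for x
      using h(3)[OF that] mult_left_mono[OF W[OF that] h(4)]
      by simp
    then show ?thesis
      unfolding M_converges_def
      by (rule integrable_on_Ioi_of_exp_decay[OF continuous_on_M_integrand[OF \<open>\<omega> > 0\<close> h(1)] c \<open>\<delta> > 0\<close>])
  qed
  show "M_converges_at_0 \<rho> m g u v \<omega> \<Longrightarrow> M_converges \<rho> m g u v \<omega>"
    by (rule conv[OF cont, where C' = 1]) auto
  show "M_converges_at_0 \<rho> m (\<lambda>x. of_real (x powi (-2)) * g x) u v \<omega> \<Longrightarrow>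
         M_converges \<rho> m (\<lambda>x. of_real (x powi (-2)) * g x) u v \<omega>"
  proof (rule conv[where C' = "X powi (-2)"])
    show "continuous_on {0<..} (\<lambda>x. of_real (x powi (-2)) * g x)"
      by (intro continuous_intros cont) auto
    fix x assume x: "x \<ge> X / \<omega>"
    then have "X \<le> \<omega> * x" using assms by (simp add: field_simps)
    then have "(\<omega> * x) powi (-2) \<le> X powi (-2)"
      using \<open>X > 0\<close> by (auto simp: power_int_minus intro!: le_imp_inverse_le power_mono)
    then show "norm (M_integrand \<rho> m (\<lambda>x. of_real (x powi (-2)) * g x) u v \<omega> x) \<le>
        X powi (-2) * norm (M_integrand \<rho> m g u v \<omega> x)"
      unfolding M_integrand_inverse_square norm_mult norm_of_real
      using \<open>\<omega> > 0\<close> pos[OF x] by (intro mult_right_mono) auto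
  qed (use assms in auto)
  show "M_converges_at_0 (\<rho> + 1) m (\<lambda>x. of_real (x ^ (m - 1)) * g x) u v \<omega> \<Longrightarrow>
         M_converges (\<rho> + 1) m (\<lambda>x. of_real (x ^ (m - 1)) * g x) u v \<omega>"
  \<comment> \<open>Dropping omega^m from the denominator leaves (omega x)^(m-1)/x^m =
    omega^m/(omega x), and omega x >= X. The equality relies on m >= 1.\<close>
  proof (rule conv[where C' = "\<omega> ^ m / X"])
    show "continuous_on {0<..} (\<lambda>x. of_real (x ^ (m - 1)) * g x)"
      by (intro continuous_intros cont)
    fix x assume x: "x \<ge> X / \<omega>"
    note pos[OF x]
    have "(\<omega> * x) ^ (m - 1) / (x ^ m + \<omega> ^ m) \<le> (\<omega> * x) ^ (m - 1) / x ^ m"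
      using \<open>x > 0\<close> \<open>\<omega> > 0\<close> by (intro divide_left_mono) (auto simp: add_pos_pos)
    also have "\<dots> = \<omega> ^ m / (\<omega> * x)"
      using \<open>m \<ge> 1\<close> \<open>x > 0\<close> \<open>\<omega> > 0\<close> by (cases m) (auto simp: power_mult_distrib field_simps)
    also have "\<dots> \<le> \<omega> ^ m / X"
      using x \<open>x > 0\<close> assms by (intro divide_left_mono) (auto simp: field_simps)
    finally show "norm (M_integrand (\<rho> + 1) m (\<lambda>x. of_real (x ^ (m - 1)) * g x) u v \<omega> x) \<le>
        \<omega> ^ m / X * norm (M_integrand \<rho> m g u v \<omega> x)"
      unfolding M_integrand_Suc_exponent[OF \<open>x > 0\<close> \<open>\<omega> > 0\<close>] norm_mult norm_of_real
      using \<open>x > 0\<close> \<open>\<omega> > 0\<close> by (intro mult_right_mono) auto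
  qed (use assms in auto)
  show "(M_integrand \<rho> m g u v \<omega> \<longlongrightarrow> 0) at_top"
  proof (rule Lim_null_comparison)
    show "\<forall>\<^sub>F x in at_top. norm (M_integrand \<rho> m g u v \<omega> x) \<le> C * exp (- \<delta> * x)"
      using eventually_ge_at_top[of "X / \<omega>"] W by (rule eventually_mono)
    have "filterlim (\<lambda>x. - \<delta> * x) at_bot at_top"
      using \<open>\<delta> > 0\<close> by (intro filterlim_tendsto_neg_mult_at_bot[OF tendsto_const _ filterlim_ident]) auto
    then have "((\<lambda>x. exp (- \<delta> * x)) \<longlongrightarrow> 0) at_top"
      by (rule filterlim_compose[OF exp_at_bot])
    then show "((\<lambda>x. C * exp (- \<delta> * x)) \<longlongrightarrow> 0) at_top"
      by (rule tendsto_mult_right_zero)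
  qed
qed

text \<open>The class of bounds K x^a exp(x/beta) is stable under integration, so a bound on the
  highest derivative passes down to all lower ones. Taking X >= 1 makes x^a exp(x/beta) at least 1,
  so the initial value g(X) is absorbed into the constant.\<close>

lemma exp_growth_antiderivative:
  fixes g :: "real \<Rightarrow> 'a::euclidean_space"
  assumes "countable P" "X \<ge> 1" "a \<ge> 0" "\<beta> > 0" "K \<ge> 0" and cont: "continuous_on {X..} g"
    and deriv: "\<And>x. x \<in> {X<..} - P \<Longrightarrow> (g has_vector_derivative g' x) (at x)"
    and g': "\<And>x. x \<ge> X \<Longrightarrow> x \<notin> P \<Longrightarrow> norm (g' x) \<le> K * x powr a * exp (x / \<beta>)"
  shows "\<exists>K'\<ge>0. \<forall>x\<ge>X. norm (g x) \<le> K' * x powr a * exp (x / \<beta>)"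
proof (intro exI conjI allI impI)
  show "norm (g X) + K * \<beta> \<ge> 0" using assms by simp
  fix x assume "x \<ge> X"
  \<comment> \<open>the derivative of \<open>\<phi>\<close> dominates the bound on \<open>g'\<close>\<close>
  define \<phi> where "\<phi> = (\<lambda>x. K * \<beta> * (x powr a * exp (x / \<beta>)))"
  define \<phi>' where "\<phi>' = (\<lambda>x. K * \<beta> * (a * x powr (a - 1) * exp (x / \<beta>) + x powr a * exp (x / \<beta>) / \<beta>))"
  have neg: "negligible P"
    using \<open>countable P\<close> by (rule negligible_countable)
  have "(g' has_integral (g x - g X)) {X..x}"
    using \<open>x \<ge> X\<close> assms(1) 
    by (intro fundamental_theorem_of_calculus_countable[of P] continuous_on_subset[OF cont] deriv) auto
  \<comment> \<open>No bound on \<open>g'\<close> is available on \<open>P\<close>; resetting it to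
    0 there makes the pointwise comparison hold everywhere.\<close>
  then have g0: "((\<lambda>x. if x \<in> P then 0 else g' x) has_integral (g x - g X)) {X..x}"
    by (rule has_integral_spike[OF neg, rotated]) auto
  have \<phi>: "(\<phi>' has_integral (\<phi> x - \<phi> X)) {X..x}"
  proof (rule fundamental_theorem_of_calculus[OF \<open>x \<ge> X\<close>])
    fix y assume "y \<in> {X..x}"
    then have "y > 0" using \<open>X \<ge> 1\<close> by auto
    then have "(\<phi> has_real_derivative \<phi>' y) (at y)"
      unfolding \<phi>_def \<phi>'_def by (auto intro!: derivative_eq_intros simp: field_simps)
    then show "(\<phi> has_vector_derivative \<phi>' y) (at y within {X..x})"
      by (simp add: has_real_derivative_iff_has_vector_derivative has_vector_derivative_at_within)
  qed
  have "norm (integral {X..x} (\<lambda>x. if x \<in> P then 0 else g' x)) \<le> integral {X..x} \<phi>'"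
  proof (rule integral_norm_bound_integral)
    fix y assume "y \<in> {X..x}"
    then have "K * y powr a * exp (y / \<beta>) \<le> \<phi>' y"
      using assms(2-5) by (simp add: \<phi>'_def field_simps)
    moreover have "0 \<le> K * y powr a * exp (y / \<beta>)" using \<open>K \<ge> 0\<close> by simp
    ultimately show "norm (if y \<in> P then 0 else g' y) \<le> \<phi>' y"
      using g'[of y] \<open>y \<in> _\<close> by auto
  qed (use g0 \<phi> in blast)+
  then have "norm (g x - g X) \<le> \<phi> x - \<phi> X"
    using g0 \<phi> by (simp add: integral_unique)
  moreover have "\<phi> X \<ge> 0" using assms by (simp add: \<phi>_def)
  moreover have "norm (g x) \<le> norm (g X) + norm (g x - g X)"
    by (metis norm_triangle_sub)
  ultimately have "norm (g x) \<le> norm (g X) * 1 + \<phi> x" by simp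
  moreover have "1 \<le> x powr a" "1 \<le> exp (x / \<beta>)"
    using assms \<open>x \<ge> X\<close> by (auto intro: ge_one_powr_ge_zero)
  then have "1 \<le> x powr a * exp (x / \<beta>)"
    using mult_mono[of 1 "x powr a" 1 "exp (x / \<beta>)"] by simp
  then have "norm (g X) * 1 \<le> norm (g X) * (x powr a * exp (x / \<beta>))"
    by (intro mult_left_mono) auto
  ultimately show "norm (g x) \<le> (norm (g X) + K * \<beta>) * x powr a * exp (x / \<beta>)"
    by (simp add: \<phi>_def algebra_simps)
qed

section \<open>Integration by parts over the half-line\<close>

text \<open>The total derivative integrates to the difference of the boundary limits and is then
  solved for the integrand of \<open>g'\<close>, whose convergence is thus a conclusion. For v = 0
  the x^(-2) integral may diverge, hence the guard in \<open>A\<close>.\<close>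

lemma M_transform_derivative:
  assumes "\<omega> > 0" "m \<ge> 1" "countable P" and cont: "continuous_on {0<..} g"
    and deriv: "\<And>x. x \<in> {0<..} - P \<Longrightarrow> (g has_vector_derivative g' x) (at x)"
    and W: "M_converges \<rho> m g u v \<omega>"
    and A: "v \<noteq> 0 \<Longrightarrow> M_converges \<rho> m (\<lambda>x. of_real (x powi (-2)) * g x) u v \<omega>"
    and B: "M_converges (\<rho> + 1) m (\<lambda>x. of_real (x ^ (m - 1)) * g x) u v \<omega>"
    and l: "(M_integrand \<rho> m g u v \<omega> \<longlongrightarrow> l) (at_right 0)"
    and L: "(M_integrand \<rho> m g u v \<omega> \<longlongrightarrow> 0) at_top"
  shows "M_converges \<rho> m g' u v \<omega>" (is ?conv)
    and "M_transform \<rho> m g' u v \<omega> = u / of_real \<omega> * M_transform \<rho> m g u v \<omega> - l / of_real \<omega>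
       - v * of_real \<omega> * M_transform \<rho> m (\<lambda>x. of_real (x powi (-2)) * g x) u v \<omega>
       + of_nat m * \<rho> / of_real \<omega> ^ m *
           M_transform (\<rho> + 1) m (\<lambda>x. of_real (x ^ (m - 1)) * g x) u v \<omega>" (is ?eq)
proof -
  define Wi where "Wi = M_integrand \<rho> m g u v \<omega>"
  define Wi' where "Wi' = M_integrand \<rho> m g' u v \<omega>"
  define Ai where "Ai = M_integrand \<rho> m (\<lambda>x. of_real (x powi (-2)) * g x) u v \<omega>"
  define Bi where "Bi = M_integrand (\<rho> + 1) m (\<lambda>x. of_real (x ^ (m - 1)) * g x) u v \<omega>"
  define D where "D = (\<lambda>x. of_real \<omega> * Wi' x - u * Wi x + v * of_real \<omega> ^ 2 * Ai x
      - of_nat m * \<rho> / of_real \<omega> ^ (m - 1) * Bi x)"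
  have "(D has_integral (0 - l)) {0<..}"
  proof (rule fundamental_theorem_of_calculus_Ioi)
    show "countable ((\<lambda>x. x / \<omega>) ` P)" using \<open>countable P\<close> by simp
    show "continuous_on {0<..} Wi"
      unfolding Wi_def by (rule continuous_on_M_integrand[OF \<open>\<omega> > 0\<close> cont])
    fix x assume "x \<in> {0<..} - (\<lambda>x. x / \<omega>) ` P"
    then show "(Wi has_vector_derivative D x) (at x)"
      unfolding Wi_def Wi'_def Ai_def Bi_def D_def
      by (intro M_integrand_has_vector_derivative_off[OF \<open>\<omega> > 0\<close> _ deriv])
  qed (use l L in \<open>simp_all add: Wi_def\<close>)
  from has_integral_mult_right[OF this, of "1 / of_real \<omega>"]
  have D: "((\<lambda>x. 1 / of_real \<omega> * D x) has_integral (1 / of_real \<omega> * (0 - l))) {0<..}" .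
  have W: "(Wi has_integral M_transform \<rho> m g u v \<omega>) {0<..}"
    using W by (simp add: Wi_def M_converges_def M_transform_def integrable_integral)
  \<comment> \<open>For v = 0 the factor annihilates both sides, including a default value of the
    transform.\<close>
  have A: "((\<lambda>x. v * of_real \<omega> * Ai x) has_integral v * of_real \<omega> *
      M_transform \<rho> m (\<lambda>x. of_real (x powi (-2)) * g x) u v \<omega>) {0<..}"
  proof (cases "v = 0")
    case False
    then show ?thesis
      using A by (intro has_integral_mult_right)
                 (simp add: Ai_def M_converges_def M_transform_def integrable_integral)
  qed simp
  have B: "(Bi has_integral M_transform (\<rho> + 1) m (\<lambda>x. of_real (x ^ (m - 1)) * g x) u v \<omega>) {0<..}"
    using B by (simp add: Bi_def M_converges_def M_transform_def integrable_integral)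
  have "((\<lambda>x. 1 / of_real \<omega> * D x + u / of_real \<omega> * Wi x - v * of_real \<omega> * Ai x
        + of_nat m * \<rho> / of_real \<omega> ^ m * Bi x) has_integral
      (1 / of_real \<omega> * (0 - l) + u / of_real \<omega> * M_transform \<rho> m g u v \<omega>
       - v * of_real \<omega> * M_transform \<rho> m (\<lambda>x. of_real (x powi (-2)) * g x) u v \<omega>
       + of_nat m * \<rho> / of_real \<omega> ^ m *
           M_transform (\<rho> + 1) m (\<lambda>x. of_real (x ^ (m - 1)) * g x) u v \<omega>)) {0<..}"
    by (intro has_integral_add has_integral_diff D has_integral_mult_right[OF W] A
        has_integral_mult_right[OF B])
  moreover have "1 / of_real \<omega> * D x + u / of_real \<omega> * Wi x - v * of_real \<omega> * Ai x
        + of_nat m * \<rho> / of_real \<omega> ^ m * Bi x = Wi' x" for x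
  proof -
    \<comment> \<open>Dividing by omega turns omega^(m-1) into omega^m; with truncated subtraction
      this needs m >= 1.\<close>
    have "of_real \<omega> ^ m = (of_real \<omega> * of_real \<omega> ^ (m - 1) :: complex)"
      using \<open>m \<ge> 1\<close> by (cases m) auto
    then show ?thesis
      using \<open>\<omega> > 0\<close> by (simp add: D_def power2_eq_square field_simps)
  qed
  ultimately have *: "(Wi' has_integral
      (1 / of_real \<omega> * (0 - l) + u / of_real \<omega> * M_transform \<rho> m g u v \<omega>
       - v * of_real \<omega> * M_transform \<rho> m (\<lambda>x. of_real (x powi (-2)) * g x) u v \<omega>
       + of_nat m * \<rho> / of_real \<omega> ^ m *
           M_transform (\<rho> + 1) m (\<lambda>x. of_real (x ^ (m - 1)) * g x) u v \<omega>)) {0<..}"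
    by simp
  then show ?conv by (auto simp: M_converges_def Wi'_def)
  from * show ?eq by (simp add: M_transform_def Wi'_def integral_unique)
qed

text \<open>Convergence may be conditional, so this rests on the second mean value theorem.\<close>

lemma M_converges_at_0_mult_square:
  assumes "M_converges_at_0 \<rho> m (\<lambda>x. of_real (x powi (-2)) * g x) u v \<omega>" and "\<omega> > 0"
  shows "M_converges_at_0 \<rho> m g u v \<omega>"
proof -
  let ?A = "M_integrand \<rho> m (\<lambda>x. of_real (x powi (-2)) * g x) u v \<omega>"
  obtain c where c: "c > 0" "?A integrable_on {0<..c}"
    using assms by (auto simp: M_converges_at_0_def)
  then have "?A integrable_on {0..c}" by (simp add: integrable_on_Ioc_iff)
  moreover have "mono_on {0..c} (\<lambda>x. (\<omega> * x) ^ 2)"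
    using \<open>\<omega> > 0\<close> by (intro monotone_onI power_mono mult_left_mono) auto
  ultimately have "(\<lambda>x. (\<omega> * x) ^ 2 *\<^sub>R ?A x) integrable_on {0..c}"
    by (rule integrable_monotone_mult)
  then have "(\<lambda>x. (\<omega> * x) ^ 2 *\<^sub>R ?A x) integrable_on {0<..c}"
    using \<open>c > 0\<close> by (simp add: integrable_on_Ioc_iff)
  then have "M_integrand \<rho> m g u v \<omega> integrable_on {0<..c}"
    by (rule integrable_eq)
       (use \<open>\<omega> > 0\<close> M_integrand_eq_square_mult[of _ \<omega> \<rho> m g u v] in \<open>simp add: scaleR_conv_of_real\<close>)
  with \<open>c > 0\<close> show ?thesis by (auto simp: M_converges_at_0_def)
qed

lemma M_integrand_tendsto_0_of_converges:
  assumes "\<omega> > 0" "countable P" and cont: "continuous_on {0<..} g"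
    and deriv: "\<And>x. x \<in> {0<..} - P \<Longrightarrow> (g has_vector_derivative g' x) (at x)"
    and W': "M_converges_at_0 \<rho> m g' u v \<omega>"
    and W: "M_converges_at_0 \<rho> m g u v \<omega>"
    and A: "M_converges_at_0 \<rho> m (\<lambda>x. of_real (x powi (-2)) * g x) u v \<omega>"
    and B: "M_converges_at_0 (\<rho> + 1) m (\<lambda>x. of_real (x ^ (m - 1)) * g x) u v \<omega>"
  shows "(M_integrand \<rho> m g u v \<omega> \<longlongrightarrow> 0) (at_right 0)"
proof -
  define Wi where "Wi = M_integrand \<rho> m g u v \<omega>"
  define Wi' where "Wi' = M_integrand \<rho> m g' u v \<omega>"
  define Ai where "Ai = M_integrand \<rho> m (\<lambda>x. of_real (x powi (-2)) * g x) u v \<omega>"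
  define Bi where "Bi = M_integrand (\<rho> + 1) m (\<lambda>x. of_real (x ^ (m - 1)) * g x) u v \<omega>"
  define D where "D = (\<lambda>x. of_real \<omega> * Wi' x - u * Wi x + v * of_real \<omega> ^ 2 * Ai x
      - of_nat m * \<rho> / of_real \<omega> ^ (m - 1) * Bi x)"
  obtain c1 c2 c3 c4 where c: "c1 > 0" "Wi' integrable_on {0<..c1}" "c2 > 0" "Wi integrable_on {0<..c2}"
    "c3 > 0" "Ai integrable_on {0<..c3}" "c4 > 0" "Bi integrable_on {0<..c4}"
    using W' W A B unfolding M_converges_at_0_def Wi'_def Wi_def Ai_def Bi_def by blast
  define c where "c = min (min c1 c2) (min c3 c4)"
  have "c > 0" "c \<le> c1" "c \<le> c2" "c \<le> c3" "c \<le> c4" using c by (auto simp: c_def)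
  then have int: "Wi' integrable_on {0<..c}" "Wi integrable_on {0<..c}"
      "Ai integrable_on {0<..c}" "Bi integrable_on {0<..c}"
    using c by (auto intro: integrable_on_Ioc_subset)
  then have "D integrable_on {0<..c}"
    unfolding D_def by (intro integrable_add integrable_diff integrable_on_mult_right)
  moreover have "countable ((\<lambda>x. x / \<omega>) ` P)" using \<open>countable P\<close> by simp
  moreover have "continuous_on {0<..} Wi"
    unfolding Wi_def by (rule continuous_on_M_integrand[OF \<open>\<omega> > 0\<close> cont])
  moreover have "(Wi has_vector_derivative D x) (at x)" if "x \<in> {0<..} - (\<lambda>x. x / \<omega>) ` P" for x
    unfolding Wi_def Wi'_def Ai_def Bi_def D_def
    by (rule M_integrand_has_vector_derivative_off[OF \<open>\<omega> > 0\<close> that deriv])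
  ultimately obtain l where l: "(Wi \<longlongrightarrow> l) (at_right 0)"
    using tendsto_at_right_of_integrable_derivative \<open>c > 0\<close> by metis
  \<comment> \<open>This quotient is omega^2 times the x^(-2) integrand, so its integrability forces
    the limit just found to vanish.\<close>
  moreover have "(\<lambda>x. Wi x / of_real (x ^ 2)) integrable_on {0<..c}"
  proof (rule integrable_eq)
    show "(\<lambda>x. of_real (\<omega> ^ 2) * Ai x) integrable_on {0<..c}"
      using int by (intro integrable_on_mult_right)
    show "of_real (\<omega> ^ 2) * Ai x = Wi x / of_real (x ^ 2)" if "x \<in> {0<..c}" for x
      using that \<open>\<omega> > 0\<close> M_integrand_eq_square_mult[of x \<omega> \<rho> m g u v]
      by (simp add: Ai_def Wi_def power_mult_distrib)
  qed
  ultimately have "l = 0"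
    using tendsto_0_of_integrable_divide_square \<open>c > 0\<close> by blast
  with l show ?thesis by (simp add: Wi_def)
qed

section \<open>Limits of the integrand at 0\<close>

text \<open>With y = Re v / x the modulus is y^k exp(-y) / (Re v)^k, and y tends to infinity. Both k
  = 0 and k = 2 occur; the latter absorbs the factor x^(-2).\<close>

lemma exp_inverse_tendsto_0:
  assumes "Re v > 0"
  shows "((\<lambda>x. exp (- v / of_real x) / of_real x ^ k) \<longlongrightarrow> 0) (at_right 0)"
proof (rule tendsto_norm_zero_cancel)
  have "filterlim (\<lambda>x. Re v * inverse x) at_top (at_right 0)"
    by (rule filterlim_tendsto_pos_mult_at_top[OF tendsto_const assms filterlim_inverse_at_top_right])
  from filterlim_compose[OF tendsto_power_div_exp_0 this, of k]
  have "((\<lambda>x. (Re v * inverse x) ^ k / exp (Re v * inverse x) / Re v ^ k) \<longlongrightarrow> 0 / Re v ^ k) (at_right 0)"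
    by (intro tendsto_divide tendsto_const) (use assms in auto)
  moreover have "\<forall>\<^sub>F x in at_right 0. (Re v * inverse x) ^ k / exp (Re v * inverse x) / Re v ^ k =
      norm (exp (- v / of_real x) / of_real x ^ k)"
    using eventually_at_right_less
  proof eventually_elim
    case (elim x)
    then show ?case
      using assms by (simp add: norm_divide norm_mult norm_power exp_minus power_mult_distrib field_simps)
  qed
  ultimately show "((\<lambda>x. norm (exp (- v / of_real x) / of_real x ^ k)) \<longlongrightarrow> 0) (at_right 0)"
    by (simp add: tendsto_cong)
qed

text \<open>Only exp(-v/x)/x^k can be singular at 0, so its limit \<open>e\<close> is left as a
  parameter; the other factors have limits of their own. Since m >= 1, the base tends to
  omega^m.\<close>

lemma tendsto_M_integrand_divide_power:
  assumes "\<omega> > 0" "m \<ge> 1" and g: "(g \<longlongrightarrow> l) (at_right 0)"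
    and e: "((\<lambda>x. exp (- v / of_real x) / of_real x ^ k) \<longlongrightarrow> e) (at_right 0)"
  shows "((\<lambda>x. M_integrand \<rho> m g u v \<omega> x / of_real x ^ k) \<longlongrightarrow> e * l / of_real (\<omega> ^ m) powr \<rho>)
    (at_right 0)"
proof -
  have "filterlim (\<lambda>x. \<omega> * x) (at_right 0) (at_right 0)"
    using \<open>\<omega> > 0\<close> by (intro filterlim_times_pos[OF filterlim_ident]) auto
  from filterlim_compose[OF g this] have "((\<lambda>x. g (\<omega> * x)) \<longlongrightarrow> l) (at_right 0)" .
  moreover have "((\<lambda>x. of_real (x ^ m + \<omega> ^ m) powr \<rho>) \<longlongrightarrow> of_real (0 ^ m + \<omega> ^ m) powr \<rho>) (at_right 0)"
    using assms(1,2) by (intro tendsto_powr_complex tendsto_intros)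
       (auto simp: complex_nonpos_Reals_iff power_0_left not_le)
  moreover have "((\<lambda>x. exp (- u * of_real x)) \<longlongrightarrow> exp (- u * of_real 0)) (at_right 0)"
    by (intro tendsto_intros)
  ultimately have "((\<lambda>x. exp (- u * of_real x) * (exp (- v / of_real x) / of_real x ^ k) /
      of_real (x ^ m + \<omega> ^ m) powr \<rho> * g (\<omega> * x)) \<longlongrightarrow>
      exp (- u * of_real 0) * e / of_real (0 ^ m + \<omega> ^ m) powr \<rho> * l) (at_right 0)"
    using assms(1,2) e by (intro tendsto_mult tendsto_divide) (auto simp: power_0_left)
  then show ?thesis
    using \<open>m \<ge> 1\<close> by (simp add: M_integrand_def exp_diff exp_minus field_simps power_0_left)
qed

lemma M_converges_at_0_of_tendsto:
  assumes "\<omega> > 0" "continuous_on {0<..} g" "(M_integrand \<rho> m g u v \<omega> \<longlongrightarrow> l) (at_right 0)"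
  shows "M_converges_at_0 \<rho> m g u v \<omega>"
  unfolding M_converges_at_0_def
  using integrable_on_Ioc_of_tendsto[OF continuous_on_M_integrand[OF assms(1,2)] assms(3), of 1]
  by (intro exI[of _ 1]) simp

text \<open>The intervals [1/(k+1), k] exhaust the open half-line, and each meets \<open>P\<close>
  in a finite set.\<close>

lemma countable_of_piecewise_continuous_pos:
  assumes "piecewise_continuous_pos P g"
  shows "countable P"
proof (rule countable_subset)
  have fin: "finite (P \<inter> {inverse (real (Suc k))..real k})" for k
    using assms by (auto simp: piecewise_continuous_pos_def)
  show "countable (\<Union>k. P \<inter> {inverse (real (Suc k))..real k})"
    by (intro countable_UN countableI_type countable_finite[OF fin])
  show "P \<subseteq> (\<Union>k. P \<inter> {inverse (real (Suc k))..real k})"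
  proof
    fix x assume "x \<in> P"
    then have "x > 0" using assms by (auto simp: piecewise_continuous_pos_def)
    obtain k :: nat where "max x (inverse x) \<le> real k" using real_arch_simple by blast
    moreover from this have "inverse (real (Suc k)) \<le> inverse (inverse x)"
      using \<open>x > 0\<close> by (intro le_imp_inverse_le) auto
    ultimately show "x \<in> (\<Union>k. P \<inter> {inverse (real (Suc k))..real k})"
      using \<open>x \<in> P\<close> by auto
  qed
qed

text \<open>Matches the constant produced by the boundary terms with the power in the formula. There
  is no branch problem because omega is a positive real.\<close>

lemma of_real_powr_shift:
  assumes "\<omega> > 0"
  shows "(of_real \<omega> :: complex) powr (of_nat m * \<rho> + of_nat k + 1) =
    of_real (\<omega> ^ m) powr \<rho> * of_real \<omega> ^ k * of_real \<omega>"
proof -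
  have "(of_real \<omega> :: complex) powr (of_nat m * \<rho>) = of_real (\<omega> ^ m) powr \<rho>"
    using assms by (simp add: powr_def Ln_of_real ln_realpow mult_ac del: of_real_power)
  then show ?thesis using assms by (simp add: powr_add powr_nat' del: of_real_power)
qed

section \<open>Iterating the recurrence up to the n-th derivative\<close>

text \<open>The assumption at the lower limit has two forms. If v = 0 or Re v > 0, one-sided limits
  of the derivatives at 0 suffice. For any nonzero v one may instead assume convergence near 0; then
  the kernel need not decay there, and no boundary values enter. Convergence at infinity is always
  derived. The convergence claims exclude that the identity rests on the default value 0 of a
  divergent integral; for v = 0 the x^(-2) integrals are multiplied by v and carry no claim.\<close>

theorem theorem2p5:
  fixes \<rho> u v :: complex and m n :: nat and f :: "real \<Rightarrow> complex" and P :: "real set"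
    and K T \<beta> \<mu> \<omega> :: real
  assumes "Re \<rho> > 0" and "m \<ge> 1" and "n \<ge> 1"
    and "has_piecewise_continuous_nth_deriv n P f"
    and "K > 0" and "T > 0" and "\<beta> > 0"
    and "\<And>x. x > T \<Longrightarrow> x \<notin> P \<Longrightarrow>
           norm (nth_deriv n f x) \<le> K * x powr (real m * Re \<rho>) * exp (x / \<beta>)"
    and "\<mu> > 0" and "0 < \<omega>" and "\<omega> < \<mu>" and "Re u > \<mu> / \<beta>"
    and "((v = 0 \<or> Re v > 0) \<and> (\<forall>j<n. \<exists>l. (nth_deriv j f \<longlongrightarrow> l) (at_right 0))) \<or>
         (v \<noteq> 0 \<and>
          M_converges_at_0 \<rho> m (nth_deriv n f) u v \<omega> \<and>
          M_converges_at_0 \<rho> m f u v \<omega> \<and>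
          (\<forall>k<n. M_converges_at_0 \<rho> m (\<lambda>x. of_real (x powi (-2)) * nth_deriv (n - k - 1) f x) u v \<omega> \<and>
                 M_converges_at_0 (\<rho> + 1) m (\<lambda>x. of_real (x ^ (m - 1)) * nth_deriv (n - k - 1) f x) u v \<omega>))"
  shows "M_converges \<rho> m (nth_deriv n f) u v \<omega> \<and>
         M_converges \<rho> m f u v \<omega> \<and>
         (\<forall>k<n. (v \<noteq> 0 \<longrightarrow>
                   M_converges \<rho> m (\<lambda>x. of_real (x powi (-2)) * nth_deriv (n - k - 1) f x) u v \<omega>) \<and>
                M_converges (\<rho> + 1) m (\<lambda>x. of_real (x ^ (m - 1)) * nth_deriv (n - k - 1) f x) u v \<omega>) \<and>
         M_transform \<rho> m (nth_deriv n f) u v \<omega> =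
           u ^ n / of_real \<omega> ^ n * M_transform \<rho> m f u v \<omega>
           - (if v = 0 then 1 else 0) *
             (\<Sum>k<n. u ^ k / of_real \<omega> powr (of_nat m * \<rho> + of_nat k + 1)
                       * value_at_0 (nth_deriv (n - k - 1) f))
           - v * of_real \<omega> *
             (\<Sum>k<n. u ^ k / of_real \<omega> ^ k
                       * M_transform \<rho> m (\<lambda>x. of_real (x powi (-2)) * nth_deriv (n - k - 1) f x) u v \<omega>)
           + of_nat m * \<rho> / of_real \<omega> ^ m *
             (\<Sum>k<n. u ^ k / of_real \<omega> ^ k
                       * M_transform (\<rho> + 1) m (\<lambda>x. of_real (x ^ (m - 1)) * nth_deriv (n - k - 1) f x) u v \<omega>)"
proof -
  note \<rho> = assms(1) and m = assms(2) and n = assms(3) and pw = assms(4) and \<omega> = \<open>0 < \<omega>\<close>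
  define D where "D = (\<lambda>j. nth_deriv j f)"
  define A where "A = (\<lambda>j x. of_real (x powi (-2)) * D j x)"
  define B where "B = (\<lambda>j x. of_real (x ^ (m - 1)) * D j x)"
  \<comment> \<open>One more than \<open>T\<close>, so that the strict bound holds from
    \<open>X\<close> on and X >= 1, as integrating the bound requires.\<close>
  define X where "X = T + 1"
  have D_Suc: "D (Suc j) = (\<lambda>x. vector_derivative (D j) (at x))" for j
    by (simp add: D_def nth_deriv_def)
  have "countable P"
    using pw countable_of_piecewise_continuous_pos
    by (auto simp: has_piecewise_continuous_nth_deriv_def)
  have D_diff: "D j differentiable at x" if "j < n" "x \<in> {0<..} - P" for j x
  proof (cases "Suc j < n")
    case False
    then have "j = n - 1" using that by simp
    then show ?thesis using pw that by (simp add: has_piecewise_continuous_nth_deriv_def D_def)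
  qed (use pw that in \<open>auto simp: has_piecewise_continuous_nth_deriv_def D_def\<close>)
  have D_deriv: "(D j has_vector_derivative D (Suc j) x) (at x)" if "j < n" "x \<in> {0<..} - P" for j x
    using D_diff[OF that] by (simp add: D_Suc vector_derivative_works)
  have D_cont: "continuous_on {0<..} (D j)" if "j < n" for j
  proof (cases "Suc j < n")
    case True
    then have "\<And>x. x > 0 \<Longrightarrow> D j differentiable at x"
      using pw by (simp add: has_piecewise_continuous_nth_deriv_def D_def)
    then show ?thesis
      by (intro continuous_at_imp_continuous_on ballI differentiable_imp_continuous_within) auto
  next
    case False
    then have "j = n - 1" using that by simp
    then show ?thesis using pw by (simp add: has_piecewise_continuous_nth_deriv_def D_def)
  qed

  \<comment> \<open>Induction downwards from order n. Points of \<open>P\<close> are excluded only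
    at i = 0; each integrated bound holds everywhere, with a new constant.\<close>
  have growth: "\<exists>K\<ge>0. \<forall>x\<ge>X. x \<notin> P \<or> i > 0 \<longrightarrow>
      norm (D (n - i) x) \<le> K * x powr (real m * Re \<rho>) * exp (x / \<beta>)" if "i \<le> n" for i
    using that
  proof (induction i)
    case 0
    show ?case
      using assms(5,8) by (intro exI[of _ K]) (auto simp: X_def D_def)
  next
    case (Suc i)
    then obtain K' where K': "K' \<ge> 0" "\<And>x. x \<ge> X \<Longrightarrow> x \<notin> P \<Longrightarrow>
        norm (D (n - i) x) \<le> K' * x powr (real m * Re \<rho>) * exp (x / \<beta>)"
      by auto
    have j: "n - Suc i < n" "Suc (n - Suc i) = n - i" using Suc.prems by auto
    have "\<exists>K'\<ge>0. \<forall>x\<ge>X. norm (D (n - Suc i) x) \<le> K' * x powr (real m * Re \<rho>) * exp (x / \<beta>)"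
    proof (rule exp_growth_antiderivative[OF \<open>countable P\<close> _ _ \<open>\<beta> > 0\<close> K'(1) _ _ K'(2)])
      show "continuous_on {X..} (D (n - Suc i))"
        by (rule continuous_on_subset[OF D_cont[OF j(1)]]) (use \<open>T > 0\<close> in \<open>auto simp: X_def\<close>)
      show "(D (n - Suc i) has_vector_derivative D (n - i) x) (at x)" if "x \<in> {X<..} - P" for x
        using D_deriv[OF j(1), of x] that \<open>T > 0\<close> by (simp add: j X_def)
    qed (use \<open>T > 0\<close> \<rho> in \<open>auto simp: X_def\<close>)
    then show ?case by blast
  qed
  have D_growth: "\<exists>K\<ge>0. \<forall>x\<ge>X. norm (D j x) \<le> K * x powr (real m * Re \<rho>) * exp (x / \<beta>)" if "j < n" for j
    using growth[of "n - j"] that by auto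
  have u: "\<omega> / \<beta> < Re u"
    using assms by (meson divide_strict_right_mono less_trans)
  have "X > 0" using \<open>T > 0\<close> by (simp add: X_def)
  have conv: "M_converges_at_0 \<rho> m (D j) u v \<omega> \<Longrightarrow> M_converges \<rho> m (D j) u v \<omega>"
      "M_converges_at_0 \<rho> m (A j) u v \<omega> \<Longrightarrow> M_converges \<rho> m (A j) u v \<omega>"
      "M_converges_at_0 (\<rho> + 1) m (B j) u v \<omega> \<Longrightarrow> M_converges (\<rho> + 1) m (B j) u v \<omega>"
    and D_top: "(M_integrand \<rho> m (D j) u v \<omega> \<longlongrightarrow> 0) at_top" if "j < n" for j
  proof -
    obtain K' where K': "K' \<ge> 0" "\<And>x. x \<ge> X \<Longrightarrow>
        norm (D j x) \<le> K' * x powr (real m * Re \<rho>) * exp (x / \<beta>)"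
      using D_growth[OF \<open>j < n\<close>] by blast
    note * = M_converges_of_exp_growth[OF \<omega> \<open>X > 0\<close> \<rho> K'(1) m u D_cont[OF \<open>j < n\<close>] K'(2)]
    show "M_converges_at_0 \<rho> m (D j) u v \<omega> \<Longrightarrow> M_converges \<rho> m (D j) u v \<omega>"
      by (rule *(1))
    show "M_converges_at_0 \<rho> m (A j) u v \<omega> \<Longrightarrow> M_converges \<rho> m (A j) u v \<omega>"
      unfolding A_def by (rule *(2))
    show "M_converges_at_0 (\<rho> + 1) m (B j) u v \<omega> \<Longrightarrow> M_converges (\<rho> + 1) m (B j) u v \<omega>"
      unfolding B_def by (rule *(3))
    show "(M_integrand \<rho> m (D j) u v \<omega> \<longlongrightarrow> 0) at_top"
      by (rule *(4))
  qed

  \<comment> \<open>The limit of the integrand of order \<open>j\<close> at 0; its vanishing for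
    nonzero v is the source of the delta factor in the formula.\<close>
  define L where "L = (\<lambda>j. if v = 0 then value_at_0 (D j) / of_real (\<omega> ^ m) powr \<rho> else 0)"
  have at_0: "M_converges_at_0 \<rho> m (D j) u v \<omega> \<and> (v \<noteq> 0 \<longrightarrow> M_converges_at_0 \<rho> m (A j) u v \<omega>) \<and>
      M_converges_at_0 (\<rho> + 1) m (B j) u v \<omega> \<and> (M_integrand \<rho> m (D j) u v \<omega> \<longlongrightarrow> L j) (at_right 0)"
    if "j < n" for j
    using assms(13)
  proof
    assume *: "(v = 0 \<or> Re v > 0) \<and> (\<forall>j<n. \<exists>l. (nth_deriv j f \<longlongrightarrow> l) (at_right 0))"
    then obtain l where l: "(D j \<longlongrightarrow> l) (at_right 0)" using \<open>j < n\<close> by (auto simp: D_def)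
    then have l_eq: "value_at_0 (D j) = l" by (simp add: value_at_0_def tendsto_Lim)
    have e: "((\<lambda>x. exp (- v / of_real x) / of_real x ^ 0) \<longlongrightarrow> (if v = 0 then 1 else 0)) (at_right 0)"
      using * exp_inverse_tendsto_0[of v 0] by auto
    have W: "(M_integrand \<rho> m (D j) u v \<omega> \<longlongrightarrow> L j) (at_right 0)"
      using tendsto_M_integrand_divide_power[OF \<omega> m l e, of \<rho> u] by (simp add: L_def l_eq split: if_splits)
    have "(B j \<longlongrightarrow> of_real (0 ^ (m - 1)) * l) (at_right 0)"
      unfolding B_def by (intro tendsto_intros l)
    from tendsto_M_integrand_divide_power[OF \<omega> m this e, of "\<rho> + 1" u]
    have "M_converges_at_0 (\<rho> + 1) m (B j) u v \<omega>"
      by (intro M_converges_at_0_of_tendsto[OF \<omega>]) (auto simp: B_def intro!: continuous_intros D_cont that)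
    moreover have "M_converges_at_0 \<rho> m (A j) u v \<omega>" if "v \<noteq> 0"
    proof -
      have "Re v > 0" using that * by auto
      \<comment> \<open>Here k = 2: the decay of exp(-v/x) outweighs x^(-2).\<close>
      have "((\<lambda>x. M_integrand \<rho> m (D j) u v \<omega> x / of_real x ^ 2 / of_real \<omega> ^ 2) \<longlongrightarrow>
          0 * l / of_real (\<omega> ^ m) powr \<rho> / of_real \<omega> ^ 2) (at_right 0)"
        using \<omega> by (intro tendsto_divide[OF tendsto_M_integrand_divide_power[OF \<omega> m l
              exp_inverse_tendsto_0[OF \<open>Re v > 0\<close>]] tendsto_const]) auto
      moreover have "M_integrand \<rho> m (D j) u v \<omega> x / of_real x ^ 2 / of_real \<omega> ^ 2 =
          M_integrand \<rho> m (A j) u v \<omega> x" for x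
        unfolding A_def M_integrand_inverse_square by (simp add: power_int_minus field_simps)
      ultimately have "(M_integrand \<rho> m (A j) u v \<omega> \<longlongrightarrow> 0) (at_right 0)" by simp
      then show ?thesis
        by (rule M_converges_at_0_of_tendsto[OF \<omega>, rotated])
           (auto simp: A_def intro!: continuous_intros D_cont \<open>j < n\<close>)
    qed
    ultimately show ?thesis
      using W M_converges_at_0_of_tendsto[OF \<omega> D_cont[OF that]] by blast
  next
    assume *: "v \<noteq> 0 \<and>
          M_converges_at_0 \<rho> m (nth_deriv n f) u v \<omega> \<and>
          M_converges_at_0 \<rho> m f u v \<omega> \<and>
          (\<forall>k<n. M_converges_at_0 \<rho> m (\<lambda>x. of_real (x powi (-2)) * nth_deriv (n - k - 1) f x) u v \<omega> \<and>
                 M_converges_at_0 (\<rho> + 1) m (\<lambda>x. of_real (x ^ (m - 1)) * nth_deriv (n - k - 1) f x) u v \<omega>)"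
    have AB: "M_converges_at_0 \<rho> m (A i) u v \<omega>" "M_converges_at_0 (\<rho> + 1) m (B i) u v \<omega>" if "i < n" for i
    proof -
      \<comment> \<open>The reindexing k = n - 1 - i shows that the assumptions over k cover every
        order below n.\<close>
      have "n - (n - 1 - i) - 1 = i" "n - 1 - i < n" using that by auto
      with * show "M_converges_at_0 \<rho> m (A i) u v \<omega>" "M_converges_at_0 (\<rho> + 1) m (B i) u v \<omega>"
        unfolding A_def B_def D_def by metis+
    qed
    \<comment> \<open>Orders strictly between 0 and n are not among the assumed ones; multiplying
      the x^(-2) integrand by (omega x)^2 supplies them.\<close>
    have W: "M_converges_at_0 \<rho> m (D i) u v \<omega>" if "i \<le> n" for i
    proof (cases "i = n")
      case False
      then have "M_converges_at_0 \<rho> m (A i) u v \<omega>" using that by (intro AB) auto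
      then show ?thesis unfolding A_def using \<omega> by (rule M_converges_at_0_mult_square)
    qed (use * in \<open>simp add: D_def\<close>)
    have "(M_integrand \<rho> m (D j) u v \<omega> \<longlongrightarrow> 0) (at_right 0)"
    proof (rule M_integrand_tendsto_0_of_converges[OF \<omega> \<open>countable P\<close> D_cont[OF that] D_deriv[OF that]])
      show "M_converges_at_0 \<rho> m (D (Suc j)) u v \<omega>" "M_converges_at_0 \<rho> m (D j) u v \<omega>"
        using that by (auto intro: W)
    qed (use AB[OF that] in \<open>simp_all only: A_def B_def\<close>)
    with * AB[OF that] W[of j] that show ?thesis by (simp add: L_def)
  qed

  \<comment> \<open>For j = n - 1 this also gives convergence for the n-th derivative, which is only
    piecewise continuous and so not covered by \<open>conv\<close>.\<close>
  have step: "M_converges \<rho> m (D (Suc j)) u v \<omega>"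
    "M_transform \<rho> m (D (Suc j)) u v \<omega> = u / of_real \<omega> * M_transform \<rho> m (D j) u v \<omega> - L j / of_real \<omega>
       - v * of_real \<omega> * M_transform \<rho> m (A j) u v \<omega>
       + of_nat m * \<rho> / of_real \<omega> ^ m * M_transform (\<rho> + 1) m (B j) u v \<omega>" if "j < n" for j
  proof -
    have "M_converges \<rho> m (D j) u v \<omega>" "v \<noteq> 0 \<Longrightarrow> M_converges \<rho> m (A j) u v \<omega>"
      "M_converges (\<rho> + 1) m (B j) u v \<omega>" "(M_integrand \<rho> m (D j) u v \<omega> \<longlongrightarrow> L j) (at_right 0)"
      using at_0[OF that] conv[OF that] by auto
    note * = M_transform_derivative[OF \<omega> m \<open>countable P\<close> D_cont[OF that] D_deriv[OF that]
        this[unfolded A_def B_def] D_top[OF that]]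
    show "M_converges \<rho> m (D (Suc j)) u v \<omega>" by (rule *(1))
    show "M_transform \<rho> m (D (Suc j)) u v \<omega> = u / of_real \<omega> * M_transform \<rho> m (D j) u v \<omega>
       - L j / of_real \<omega> - v * of_real \<omega> * M_transform \<rho> m (A j) u v \<omega>
       + of_nat m * \<rho> / of_real \<omega> ^ m * M_transform (\<rho> + 1) m (B j) u v \<omega>"
      unfolding A_def B_def by (rule *(2))
  qed

  \<comment> \<open>The top order stays fixed while \<open>i\<close> counts the applications of the
    recurrence; the k-th of them, counted from 0, lowers order n - k to n - k - 1. The case i = n is
    the formula.\<close>
  have iterate: "M_transform \<rho> m (D n) u v \<omega> = (u / of_real \<omega>) ^ i * M_transform \<rho> m (D (n - i)) u v \<omega>
      - (\<Sum>k<i. (u / of_real \<omega>) ^ k * (L (n - k - 1) / of_real \<omega>))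
      - v * of_real \<omega> * (\<Sum>k<i. (u / of_real \<omega>) ^ k * M_transform \<rho> m (A (n - k - 1)) u v \<omega>)
      + of_nat m * \<rho> / of_real \<omega> ^ m *
          (\<Sum>k<i. (u / of_real \<omega>) ^ k * M_transform (\<rho> + 1) m (B (n - k - 1)) u v \<omega>)"
    if "i \<le> n" for i
    using that
  proof (induction i)
    case (Suc i)
    then have "i \<le> n" by simp
    define j where "j = n - Suc i"
    have j: "n - i = Suc j" "j < n" using Suc.prems by (auto simp: j_def)
    show ?case
      unfolding Suc.IH[OF \<open>i \<le> n\<close>] j(1) j_def[symmetric] step(2)[OF j(2)] sum.lessThan_Suc power_Suc
      by (simp add: algebra_simps)
  qed simp
  have L_sum: "(\<Sum>k<n. (u / of_real \<omega>) ^ k * (L (n - k - 1) / of_real \<omega>)) =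
      (if v = 0 then 1 else 0) * (\<Sum>k<n. u ^ k / of_real \<omega> powr (of_nat m * \<rho> + of_nat k + 1)
                       * value_at_0 (D (n - k - 1)))"
    unfolding of_real_powr_shift[OF \<omega>] using \<omega>
    by (simp add: L_def power_divide field_simps del: of_real_power)
  have "M_converges \<rho> m (D n) u v \<omega>" using step(1)[of "n - 1"] n by simp
  moreover have "M_converges \<rho> m (D 0) u v \<omega>" using at_0[of 0] conv(1)[of 0] n by simp
  moreover have "(v \<noteq> 0 \<longrightarrow> M_converges \<rho> m (A (n - k - 1)) u v \<omega>) \<and>
      M_converges (\<rho> + 1) m (B (n - k - 1)) u v \<omega>" if "k < n" for k
    using at_0[of "n - k - 1"] conv(2,3)[of "n - k - 1"] that by simp
  moreover have "D 0 = f" by (simp add: D_def nth_deriv_def)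
  ultimately show ?thesis
    using iterate[of n] unfolding L_sum A_def B_def
    by (simp add: D_def power_divide)
qed

end
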